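(* Let $f$ be a complex-valued arithmetic function such that there exist $A>0$ and an integer $k \geqslant 1$ with $|f(n)| \leqslant A\,\tau_k(n)$ for all $n \geqslant 1$. Then, for all sufficiently large real $x$, $$\sum_{n \leqslant x} f\left(\left\lfloor x/n \right\rfloor\right) = x \sum_{n=1}^{\infty} \frac{f(n)}{n(n+1)} + O_{k}\left( A\,x^{1/2} (\log x)^{\delta_k+\varepsilon_{k+1}(x)/2}\right),$$ where the implied constant depends only on $k$, $\delta_1 = 0$, and $\delta_k = k-1/2$ for $k \geqslant 2$.
   Context: $\tau_k(n)$ is the generalised divisor function: the number of ordered representations $n=d_1\cdots d_k$ with positive integers $d_1,\dots,d_k$ (so $\tau_1(n)=1$). For an integer $m \geqslant 2$, $$\varepsilon_m(x) = \sqrt{\frac{m \log \log \log x}{\log \log x}} \left( m -1 + \frac{30}{\log \log \log x} \right),$$ and $\varepsilon_1(x)=0$. $\lfloor \cdot\rfloor$ denotes the integer part. *)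

theory Defs
  imports Complex_Main
begin

definition tau :: "nat \<Rightarrow> nat \<Rightarrow> nat" where
  "tau k n = card {ds :: nat list. length ds = k \<and> (\<forall>d\<in>set ds. 0 < d) \<and> prod_list ds = n}"

text \<open>Only \<open>m \<ge> 1\<close> and \<open>x > exp (exp 1)\<close> (so that \<open>ln (ln (ln x)) > 0\<close>) are meaningful.\<close>

definition eps :: "nat \<Rightarrow> real \<Rightarrow> real" where
  "eps m x = (if m = 1 then 0
     else sqrt (real m * ln (ln (ln x)) / ln (ln x)) * (real m - 1 + 30 / ln (ln (ln x))))"

definition delta :: "nat \<Rightarrow> real" where
  "delta k = (if k = 1 then 0 else real k - 1/2)"

end

theory Submission
  imports Defs "HOL-Computational_Algebra.Primes" "HOL-Real_Asymp.Real_Asymp"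
begin

text \<open>
  Put \<open>D = \<lfloor>(x ln x)\<^sup>1\<^sup>/\<^sup>2\<rfloor>\<close> (for \<open>k = 1\<close> just \<open>D = \<lfloor>x\<^sup>1\<^sup>/\<^sup>2\<rfloor>\<close>). The terms with \<open>\<lfloor>x/n\<rfloor> = d \<le> D\<close>
  contribute \<open>f(d) (\<lfloor>x/d\<rfloor> - \<lfloor>x/(d+1)\<rfloor>)\<close>, which costs \<open>O(\<Sum>d\<le>D. \<tau>\<^sub>k(d))\<close>. The others have
  \<open>n \<le> y = x/(D+1)\<close>; since \<open>n\<lfloor>x/n\<rfloor>\<close> lies in \<open>(x-y, x]\<close>, they are dominated by the sum of \<open>\<tau>\<^sub>k\<^sub>+\<^sub>1\<close>
  over that short interval, for which a bound \<open>O(y (ln x)\<^sup>k)\<close> of Shiu's type is needed.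

  For the latter write \<open>n = b c\<close>, where \<open>b \<le> z = x\<^sup>1\<^sup>/\<^sup>3\<close> is a maximal product of the smallest prime
  factors of \<open>n\<close>. If the next prime \<open>q\<close> is \<open>z\<^sup>1\<^sup>/\<^sup>u\<close>, then \<open>c\<close> has at most \<open>3u\<close> prime factors, so
  \<open>\<tau>\<^sub>m(n) \<le> m\<^sup>3\<^sup>u \<tau>\<^sub>m(b)\<close>, while \<open>b \<ge> z\<^sup>1\<^sup>/\<^sup>2\<close> is \<open>q\<close>-smooth when \<open>u \<ge> 2\<close>; Rankin's trick then gains
  \<open>exp (-\<kappa>u/2)\<close> with \<open>\<kappa>\<close> as large as desired. No sieve is needed: \<open>\<tau>\<^sub>m(b) b\<^sup>\<alpha>\<close> is expanded into a sum
  over divisors of \<open>n\<close>, and the expansion loses only \<open>m - 1\<close> logarithms because \<open>\<tau>\<^sub>m = 1 * \<tau>\<^sub>m\<^sub>-\<^sub>1\<close>.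
  The primes \<open>q\<close> below a constant are left to the bound \<open>\<tau>\<^sub>m(n) = O(n\<^sup>\<epsilon>)\<close>.
\<close>


subsection \<open>Divisor functions\<close>

lemma finite_factorisations:
  assumes "n > 0"
  shows "finite {ds :: nat list. length ds = k \<and> (\<forall>d\<in>set ds. 0 < d) \<and> prod_list ds = n}"
proof (rule finite_subset)
  show "{ds :: nat list. length ds = k \<and> (\<forall>d\<in>set ds. 0 < d) \<and> prod_list ds = n}
      \<subseteq> {ds. set ds \<subseteq> {d. d dvd n} \<and> length ds = k}"
    using prod_list_dvd by blast
  show "finite {ds. set ds \<subseteq> {d. d dvd n} \<and> length ds = k}"
    using assms by (intro finite_lists_length_eq) simp
qed

lemma tau_0: "tau 0 n = (if n = 1 then 1 else 0)"
proof -
  have "{ds :: nat list. length ds = 0 \<and> (\<forall>d\<in>set ds. 0 < d) \<and> prod_list ds = n} = (if n = 1 then {[]} else {})"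
    by auto
  then show ?thesis unfolding tau_def by simp
qed

text \<open>The first entry of a factor list is a divisor \<open>d\<close> of \<open>n\<close> and
  the remaining entries form a factorisation of \<open>n div d\<close>; different heads give
  disjoint sets.\<close>

lemma tau_Suc:
  assumes "n > 0"
  shows "tau (Suc k) n = (\<Sum>d | d dvd n. tau k (n div d))"
proof -
  let ?T = "\<lambda>k n. {ds :: nat list. length ds = k \<and> (\<forall>d\<in>set ds. 0 < d) \<and> prod_list ds = n}"
  have pos: "0 < n div d" if "d dvd n" for d
    using that assms by (auto elim!: dvdE)
  have eq: "?T (Suc k) n = (\<Union>d\<in>{d. d dvd n}. (#) d ` ?T k (n div d))"
  proof (intro equalityI subsetI)
    fix ds assume "ds \<in> ?T (Suc k) n"
    then obtain a es where *: "ds = a # es" "length es = k" "0 < a" "\<forall>d\<in>set es. 0 < d" "a * prod_list es = n"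
      by (cases ds) auto
    have "n div a = prod_list es" unfolding *(5)[symmetric] using *(3) by simp
    then have "es \<in> ?T k (n div a)" using *(2,4) by simp
    moreover have "a dvd n" unfolding *(5)[symmetric] by simp
    ultimately show "ds \<in> (\<Union>d\<in>{d. d dvd n}. (#) d ` ?T k (n div d))"
      unfolding *(1) by (intro UN_I[of a]) (auto simp del: mem_Collect_eq)
  next
    fix ds assume "ds \<in> (\<Union>d\<in>{d. d dvd n}. (#) d ` ?T k (n div d))"
    then show "ds \<in> ?T (Suc k) n"
      using assms by (auto intro: dvd_pos_nat)
  qed
  have "tau (Suc k) n = card (\<Union>d\<in>{d. d dvd n}. (#) d ` ?T k (n div d))"
    unfolding tau_def eq ..
  also have "\<dots> = (\<Sum>d | d dvd n. card ((#) d ` ?T k (n div d)))"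
    using assms pos by (intro card_UN_disjoint) (auto intro!: finite_imageI finite_factorisations)
  also have "\<dots> = (\<Sum>d | d dvd n. tau k (n div d))"
    unfolding tau_def by (intro sum.cong refl card_image) (auto simp: inj_on_def)
  finally show ?thesis .
qed

text \<open>The involution \<open>d \<mapsto> n div d\<close> turns the previous sum into the
  convolution of 1 with \<open>tau k\<close>.\<close>

lemma tau_Suc':
  assumes "n > 0"
  shows "tau (Suc k) n = (\<Sum>d | d dvd n. tau k d)"
  unfolding tau_Suc[OF assms]
  by (rule sum.reindex_bij_witness[of _ "\<lambda>d. n div d" "\<lambda>d. n div d"])
     (use assms in \<open>auto simp: dvd_div_eq_mult elim!: dvdE\<close>)

lemma tau_one:
  assumes "n > 0" shows "tau (Suc 0) n = 1"
proof -
  have "(\<Sum>d | d dvd n. tau 0 d) = (\<Sum>d\<in>{1}. tau 0 d)"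
    using assms by (intro sum.mono_neutral_right) (auto simp: tau_0)
  then show ?thesis using tau_Suc'[OF assms] by (simp add: tau_0)
qed

text \<open>Induction on \<open>m\<close>: a divisor of \<open>p * n\<close> divides
  \<open>n\<close> or is \<open>p\<close> times a divisor of \<open>n\<close>. In the recursion for
  \<open>Suc m\<close> the first kind contributes at most \<open>m\<close> copies of
  \<open>tau (Suc m) n\<close>, the second at most one more.\<close>

lemma tau_prime_mult_le:
  assumes "prime p" "n > 0"
  shows "tau m (p * n) \<le> m * tau m n"
  using assms(2)
proof (induction m arbitrary: n)
  case 0
  have "p \<noteq> 1" using assms(1) by auto
  then show ?case by (simp add: tau_0)
next
  case (Suc m)
  have p0: "p > 0" using assms(1) prime_gt_0_nat by blast
  have fin: "finite {d. d dvd n}" using Suc.prems by simp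
  have sub: "{d. d dvd p * n} \<subseteq> {d. d dvd n} \<union> (*) p ` {d. d dvd n}"
  proof
    fix d assume "d \<in> {d. d dvd p * n}"
    then have d: "d dvd p * n" by simp
    show "d \<in> {d. d dvd n} \<union> (*) p ` {d. d dvd n}"
    proof (cases "p dvd d")
      case True
      then obtain e where "d = p * e" by blast
      with d p0 show ?thesis by auto
    next
      case False
      then have "coprime d p"
        using prime_imp_coprime[OF assms(1) False] coprime_commute by blast
      with d show ?thesis by (simp add: coprime_dvd_mult_right_iff)
    qed
  qed
  have "tau (Suc m) (p * n) = (\<Sum>d | d dvd p * n. tau m (p * n div d))"
    using Suc.prems p0 by (intro tau_Suc) simp
  also have "\<dots> \<le> (\<Sum>d\<in>{d. d dvd n} \<union> (*) p ` {d. d dvd n}. tau m (p * n div d))"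
    using fin sub by (intro sum_mono2) auto
  also have "\<dots> \<le> (\<Sum>d | d dvd n. tau m (p * n div d)) + (\<Sum>d\<in>(*) p ` {d. d dvd n}. tau m (p * n div d))"
    using sum.union_inter[OF fin finite_imageI[OF fin], of "\<lambda>d. tau m (p * n div d)" "(*) p"] by linarith
  also have "(\<Sum>d\<in>(*) p ` {d. d dvd n}. tau m (p * n div d)) = (\<Sum>d | d dvd n. tau m (n div d))"
    using p0 by (subst sum.reindex) (auto simp: inj_on_def)
  also have "(\<Sum>d | d dvd n. tau m (p * n div d)) \<le> (\<Sum>d | d dvd n. m * tau m (n div d))"
  proof (rule sum_mono)
    fix d assume "d \<in> {d. d dvd n}"
    then have d: "d dvd n" by simp
    then have "n div d > 0" using Suc.prems by (auto elim!: dvdE)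
    moreover have "p * n div d = p * (n div d)" using d by (simp add: div_mult_swap)
    ultimately show "tau m (p * n div d) \<le> m * tau m (n div d)"
      using Suc.IH by simp
  qed
  also have "\<dots> + (\<Sum>d | d dvd n. tau m (n div d)) = Suc m * tau (Suc m) n"
    unfolding tau_Suc[OF Suc.prems] sum_distrib_left[symmetric] by simp
  finally show ?case by simp
qed

text \<open>Each prime factor \<open>p\<close> of \<open>c\<close> costs a factor \<open>m\<close>,
  which is \<open>q\<close> to the power \<open>ln m / ln q\<close> and so at most the same power of
  \<open>p\<close>. Multiplying over the primes of \<open>c\<close> with multiplicity rebuilds
  \<open>c\<close>.\<close>

lemma tau_mult_rough_le:
  fixes q :: real
  assumes "m \<ge> 1" "q > 1" "b > 0" "c > 0"
    and "\<And>p. prime p \<Longrightarrow> p dvd c \<Longrightarrow> q \<le> real p"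
  shows "real (tau m (b * c)) \<le> real (tau m b) * real c powr (ln (real m) / ln q)"
  using assms(4,5)
proof (induction c rule: prime_divisors_induct)
  case zero
  then show ?case by simp
next
  case (unit c)
  then show ?case by simp
next
  case (factor p c)
  have c0: "c > 0" using factor.prems(1) by simp
  have p0: "p > 0" using factor.prems(1) by simp
  have IH: "real (tau m (b * c)) \<le> real (tau m b) * real c powr (ln (real m) / ln q)"
    using factor.prems c0 by (intro factor.IH) auto
  have pq: "q \<le> real p" using factor.prems(2)[of p] factor.hyps by simp
  have "real m = q powr (ln (real m) / ln q)"
    using assms(1,2) by (simp add: powr_def)
  also have "\<dots> \<le> real p powr (ln (real m) / ln q)"
    using pq assms(1,2) by (intro powr_mono2) auto
  finally have mp: "real m \<le> real p powr (ln (real m) / ln q)" .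
  have "real (tau m (b * (p * c))) = real (tau m (p * (b * c)))"
    by (simp add: ac_simps)
  also have "\<dots> \<le> real m * real (tau m (b * c))"
    using tau_prime_mult_le[OF factor.hyps, of "b * c" m] assms(3) c0
    by (simp flip: of_nat_mult)
  also have "\<dots> \<le> real p powr (ln (real m) / ln q) * (real (tau m b) * real c powr (ln (real m) / ln q))"
    using mp IH by (intro mult_mono) auto
  also have "\<dots> = real (tau m b) * real (p * c) powr (ln (real m) / ln q)"
    by (simp add: powr_mult ac_simps)
  finally show ?case .
qed

text \<open>Writing \<open>n = d * e\<close> trades pairs (number, divisor) for pairs (divisor,
  cofactor). The set \<open>A\<close> is general so that ranges and sets of smooth numbers are
  covered alike.\<close>

lemma sum_divisor_sum:
  fixes G :: "nat \<Rightarrow> nat \<Rightarrow> 'a :: comm_monoid_add"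
  assumes "A \<subseteq> {1..N}"
  shows "(\<Sum>n\<in>A. \<Sum>d | d dvd n. G d (n div d)) = (\<Sum>d\<in>{1..N}. \<Sum>e | e \<in> {1..N} \<and> d * e \<in> A. G d e)"
proof -
  have fA: "finite A" using assms finite_subset by blast
  have "(\<Sum>n\<in>A. \<Sum>d | d dvd n. G d (n div d)) = (\<Sum>(n, d)\<in>(SIGMA n:A. {d. d dvd n}). G d (n div d))"
    using fA assms by (intro sum.Sigma) (auto dest!: subsetD)
  also have "\<dots> = (\<Sum>(d, e)\<in>(SIGMA d:{1..N}. {e. e \<in> {1..N} \<and> d * e \<in> A}). G d e)"
  proof (rule sum.reindex_bij_witness[of _ "\<lambda>(d, e). (d * e, d)" "\<lambda>(n, d). (d, n div d)"])
    fix a assume "a \<in> (SIGMA n:A. {d. d dvd n})"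
    then obtain d e where a: "a = (d * e, d)" "d * e \<in> A" by (auto elim!: dvdE)
    then have "1 \<le> d * e" "d * e \<le> N" using assms by auto
    then have *: "d \<ge> 1" "e \<ge> 1" "d * e \<le> N" by (auto simp: Suc_le_eq)
    have "d * 1 \<le> d * e" "1 * e \<le> d * e" using * by (auto intro: mult_le_mono)
    with * have "d \<le> N" "e \<le> N" by linarith+
    with a * show "(case a of (n, d) \<Rightarrow> (d, n div d)) \<in> (SIGMA d:{1..N}. {e. e \<in> {1..N} \<and> d * e \<in> A})"
      "(case (case a of (n, d) \<Rightarrow> (d, n div d)) of (d, e) \<Rightarrow> (d * e, d)) = a"
      "(case (case a of (n, d) \<Rightarrow> (d, n div d)) of (d, e) \<Rightarrow> G d e) = (case a of (n, d) \<Rightarrow> G d (n div d))"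
      by auto
  qed auto
  also have "\<dots> = (\<Sum>d\<in>{1..N}. \<Sum>e | e \<in> {1..N} \<and> d * e \<in> A. G d e)"
    by (intro sum.Sigma[symmetric]) auto
  finally show ?thesis .
qed

text \<open>Expanding the power on the right yields, for each \<open>n\<close>, one term
  \<open>g n\<close> per ordered factorisation into \<open>k\<close> parts, since \<open>g\<close>
  is completely multiplicative and \<open>P\<close> passes to the parts. The induction peels off one
  part at a time.\<close>

lemma tau_weighted_sum_le:
  fixes g :: "nat \<Rightarrow> real"
  assumes g: "\<And>n. g n \<ge> 0" "\<And>d e. g (d * e) = g d * g e" and g1: "g 1 = 1"
    and P: "\<And>d e. d > 0 \<Longrightarrow> e > 0 \<Longrightarrow> P (d * e) \<Longrightarrow> P d \<and> P e"
  shows "(\<Sum>n | n \<in> {1..N} \<and> P n. real (tau k n) * g n) \<le> (\<Sum>n | n \<in> {1..N} \<and> P n. g n) ^ k"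
proof (induction k)
  case 0
  have "(\<Sum>n | n \<in> {1..N} \<and> P n. real (tau 0 n) * g n) = (\<Sum>n | n \<in> {1..N} \<and> P n. if n = 1 then 1 else 0)"
    by (intro sum.cong) (auto simp: tau_0 g1[simplified])
  also have "\<dots> \<le> 1" by (subst sum.delta) auto
  finally show ?case by simp
next
  case (Suc k)
  let ?A = "{n. n \<in> {1..N} \<and> P n}"
  have eq1: "(\<Sum>n\<in>?A. real (tau (Suc k) n) * g n) = (\<Sum>n\<in>?A. \<Sum>d | d dvd n. g d * (real (tau k (n div d)) * g (n div d)))"
  proof (rule sum.cong[OF refl])
    fix n assume n: "n \<in> ?A"
    have "g d * (real (tau k (n div d)) * g (n div d)) = real (tau k (n div d)) * g n" if "d dvd n" for d
      using that by (simp add: mult.left_commute[of "g d"] flip: g(2))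
    then have "(\<Sum>d | d dvd n. g d * (real (tau k (n div d)) * g (n div d))) = (\<Sum>d | d dvd n. real (tau k (n div d)) * g n)"
      by (intro sum.cong refl) blast
    then show "real (tau (Suc k) n) * g n = (\<Sum>d | d dvd n. g d * (real (tau k (n div d)) * g (n div d)))"
      using n by (simp add: tau_Suc sum_distrib_right)
  qed
  have eq2: "(\<Sum>n\<in>?A. \<Sum>d | d dvd n. g d * (real (tau k (n div d)) * g (n div d))) = (\<Sum>d\<in>{1..N}. \<Sum>e | e \<in> {1..N} \<and> d * e \<in> ?A. g d * (real (tau k e) * g e))"
    by (rule sum_divisor_sum[where G = "\<lambda>d e. g d * (real (tau k e) * g e)"]) auto
  have "(\<Sum>n\<in>?A. real (tau (Suc k) n) * g n) = (\<Sum>d\<in>{1..N}. \<Sum>e | e \<in> {1..N} \<and> d * e \<in> ?A. g d * (real (tau k e) * g e))"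
    unfolding eq1 eq2 ..
  also have "\<dots> = (\<Sum>d\<in>?A. \<Sum>e | e \<in> {1..N} \<and> d * e \<in> ?A. g d * (real (tau k e) * g e))"
  proof (rule sum.mono_neutral_right; (intro ballI)?)
    fix d assume d: "d \<in> {1..N} - ?A"
    have False if "e \<in> {1..N}" "d * e \<in> ?A" for e
      using P[of d e] d that by simp
    then have "{e. e \<in> {1..N} \<and> d * e \<in> ?A} = {}" by blast
    then show "(\<Sum>e | e \<in> {1..N} \<and> d * e \<in> ?A. g d * (real (tau k e) * g e)) = 0" by (simp only: sum.empty)
  qed auto
  also have "\<dots> \<le> (\<Sum>d\<in>?A. \<Sum>e\<in>?A. g d * (real (tau k e) * g e))"
  proof (rule sum_mono)
    fix d assume d: "d \<in> ?A"
    have "P e" if "e \<in> {1..N}" "d * e \<in> ?A" for e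
      using P[of d e] d that by simp
    then have "{e. e \<in> {1..N} \<and> d * e \<in> ?A} \<subseteq> ?A" by blast
    then show "(\<Sum>e | e \<in> {1..N} \<and> d * e \<in> ?A. g d * (real (tau k e) * g e)) \<le> (\<Sum>e\<in>?A. g d * (real (tau k e) * g e))"
      by (intro sum_mono2) (auto intro!: mult_nonneg_nonneg g(1))
  qed
  also have "\<dots> = (\<Sum>d\<in>?A. g d) * (\<Sum>e\<in>?A. real (tau k e) * g e)"
    by (simp add: sum_product)
  also have "\<dots> \<le> (\<Sum>d\<in>?A. g d) * (\<Sum>d\<in>?A. g d) ^ k"
    by (intro mult_left_mono Suc.IH sum_nonneg g)
  finally show ?case by simp
qed

section \<open>Mean values and tails of divisor sums\<close>

lemma sum_inverse_le_ln:
  assumes "N \<ge> 1"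
  shows "(\<Sum>n\<in>{1..N}. 1 / real n) \<le> 1 + ln (real N)"
  using assms
proof (induction N rule: dec_induct)
  case base
  then show ?case by simp
next
  case (step N)
  have "ln (real N / real (Suc N)) \<le> real N / real (Suc N) - 1"
    using step.hyps by (intro ln_le_minus_one) auto
  also have "\<dots> = - (1 / real (Suc N))" by (simp add: field_simps)
  finally have "1 / real (Suc N) \<le> ln (real (Suc N)) - ln (real N)"
    using step.hyps by (simp add: ln_div)
  with step.IH show ?case by simp
qed

lemma sum_tau_div_le:
  assumes "N \<ge> 1"
  shows "(\<Sum>n\<in>{1..N}. real (tau k n) / real n) \<le> (1 + ln (real N)) ^ k"
proof -
  have "(\<Sum>n | n \<in> {1..N} \<and> True. real (tau k n) * (1 / real n)) \<le> (\<Sum>n | n \<in> {1..N} \<and> True. 1 / real n) ^ k"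
    by (rule tau_weighted_sum_le) auto
  also have "{n. n \<in> {1..N} \<and> True} = {1..N}" by auto
  also have "(\<Sum>n\<in>{1..N}. 1 / real n) ^ k \<le> (1 + ln (real N)) ^ k"
    by (intro power_mono sum_inverse_le_ln assms sum_nonneg) auto
  finally show ?thesis by simp
qed

text \<open>Only the \<open>k\<close> factors counted by \<open>tau k d\<close> produce logarithms:
  the remaining factor is free, and \<open>d\<close> has at most \<open>N / d\<close> multiples up
  to \<open>N\<close>.\<close>

lemma sum_tau_le:
  assumes "N \<ge> 1"
  shows "(\<Sum>n\<in>{1..N}. real (tau (Suc k) n)) \<le> real N * (1 + ln (real N)) ^ k"
proof -
  have "(\<Sum>n\<in>{1..N}. real (tau (Suc k) n)) = (\<Sum>n\<in>{1..N}. \<Sum>d | d dvd n. real (tau k d))"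
    by (intro sum.cong) (auto simp: tau_Suc')
  also have "\<dots> = (\<Sum>d\<in>{1..N}. \<Sum>e | e \<in> {1..N} \<and> d * e \<in> {1..N}. real (tau k d))"
    by (rule sum_divisor_sum[where G = "\<lambda>d e. real (tau k d)"]) simp
  also have "\<dots> \<le> (\<Sum>d\<in>{1..N}. real N * (real (tau k d) / real d))"
  proof (rule sum_mono)
    fix d assume d: "d \<in> {1..N}"
    have "card {e. e \<in> {1..N} \<and> d * e \<in> {1..N}} \<le> card {1..N div d}"
      using d by (intro card_mono) (auto simp: less_eq_div_iff_mult_less_eq mult.commute)
    then have "real (card {e. e \<in> {1..N} \<and> d * e \<in> {1..N}}) \<le> real (N div d)"
      by simp
    also have "\<dots> \<le> real N / real d" by (rule of_nat_div_le_of_nat)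
    finally have "real (card {e. e \<in> {1..N} \<and> d * e \<in> {1..N}}) * real (tau k d) \<le> real N / real d * real (tau k d)"
      by (intro mult_right_mono) auto
    then show "(\<Sum>e | e \<in> {1..N} \<and> d * e \<in> {1..N}. real (tau k d)) \<le> real N * (real (tau k d) / real d)"
      by simp
  qed
  also have "\<dots> = real N * (\<Sum>d\<in>{1..N}. real (tau k d) / real d)"
    by (rule sum_distrib_left[symmetric])
  also have "\<dots> \<le> real N * (1 + ln (real N)) ^ k"
    by (intro mult_left_mono sum_tau_div_le assms) simp
  finally show ?thesis .
qed

text \<open>Telescoping, from \<open>1 / n ^ 2 \<le> 1 / (n - 1) - 1 / n\<close>.\<close>

lemma sum_inverse_squares_le:
  assumes "D \<ge> 1"
  shows "(\<Sum>n\<in>{D<..M}. 1 / real n ^ 2) \<le> 1 / real D"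
proof (cases "D \<le> M")
  case True
  then have "(\<Sum>n\<in>{D<..M}. 1 / real n ^ 2) \<le> 1 / real D - 1 / real M"
  proof (induction M rule: dec_induct)
    case base
    then show ?case by simp
  next
    case (step M)
    have eq: "{D<..Suc M} = insert (Suc M) {D<..M}" using step.hyps by auto
    have "1 / real (Suc M) ^ 2 \<le> 1 / (real M * real (Suc M))"
      using step.hyps assms by (intro divide_left_mono) (auto simp: power2_eq_square)
    also have "\<dots> = 1 / real M - 1 / real (Suc M)"
      using step.hyps assms by (simp add: field_simps)
    finally show ?case using step.IH unfolding eq by simp
  qed
  moreover have "1 / real M \<ge> 0" by simp
  ultimately show ?thesis by linarith
next
  case False
  then show ?thesis by simp
qed

text \<open>Induction on \<open>k\<close> with \<open>n = d * e\<close>. For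
  \<open>d \<le> D\<close> the cofactor exceeds \<open>D / d\<close>, so its tail is O(d / D) and a
  logarithmic sum over \<open>d\<close> remains; for \<open>d > D\<close> the cofactor sum is
  bounded and the induction hypothesis applies. Uniformity in \<open>M\<close> later gives
  convergence of the series.\<close>

lemma sum_tau_div_square_le:
  "\<exists>C\<ge>0. \<forall>D\<ge>1. \<forall>M. (\<Sum>n\<in>{D<..M}. real (tau (Suc k) n) / real n ^ 2) \<le> C * (1 + ln (real D)) ^ k / real D"
proof (induction k)
  case 0
  have "(\<Sum>n\<in>{D<..M}. real (tau (Suc 0) n) / real n ^ 2) \<le> 1 / real D" if "D \<ge> 1" for D M
  proof -
    have "(\<Sum>n\<in>{D<..M}. real (tau (Suc 0) n) / real n ^ 2) = (\<Sum>n\<in>{D<..M}. 1 / real n ^ 2)"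
      using that by (intro sum.cong) (auto simp: tau_one)
    with sum_inverse_squares_le[OF that] show ?thesis by simp
  qed
  then show ?case by (intro exI[of _ 1]) auto
next
  case (Suc k)
  then obtain C where C: "C \<ge> 0"
    "\<And>D M. D \<ge> 1 \<Longrightarrow> (\<Sum>n\<in>{D<..M}. real (tau (Suc k) n) / real n ^ 2) \<le> C * (1 + ln (real D)) ^ k / real D"
    by blast
  let ?t = "\<lambda>n. real (tau (Suc k) n)"
  have "(\<Sum>n\<in>{D<..M}. real (tau (Suc (Suc k)) n) / real n ^ 2) \<le> (2 + 2 * C) * (1 + ln (real D)) ^ Suc k / real D"
    if D: "D \<ge> 1" for D M
  proof -
    have "(\<Sum>n\<in>{D<..M}. real (tau (Suc (Suc k)) n) / real n ^ 2)
        = (\<Sum>n\<in>{D<..M}. \<Sum>d | d dvd n. ?t d / real d ^ 2 * (1 / real (n div d) ^ 2))"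
    proof (rule sum.cong[OF refl])
      fix n assume n: "n \<in> {D<..M}"
      have "?t d / real n ^ 2 = ?t d / real d ^ 2 * (1 / real (n div d) ^ 2)" if "d dvd n" for d
        using that by (auto simp: power_mult_distrib elim!: dvdE)
      then show "real (tau (Suc (Suc k)) n) / real n ^ 2 = (\<Sum>d | d dvd n. ?t d / real d ^ 2 * (1 / real (n div d) ^ 2))"
        using n by (subst tau_Suc') (auto simp: sum_divide_distrib intro!: sum.cong)
    qed
    also have "\<dots> = (\<Sum>d\<in>{1..M}. \<Sum>e | e \<in> {1..M} \<and> d * e \<in> {D<..M}. ?t d / real d ^ 2 * (1 / real e ^ 2))"
      by (rule sum_divisor_sum[where G = "\<lambda>d e. ?t d / real d ^ 2 * (1 / real e ^ 2)"]) auto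
    also have "\<dots> = (\<Sum>d\<in>{1..M}. ?t d / real d ^ 2 * (\<Sum>e | e \<in> {1..M} \<and> d * e \<in> {D<..M}. 1 / real e ^ 2))"
      by (simp add: sum_distrib_left)
    also have "\<dots> \<le> (\<Sum>d\<in>{1..M}. if d \<le> D then 2 / real D * (?t d / real d) else 2 * (?t d / real d ^ 2))"
    proof (rule sum_mono)
      fix d assume d: "d \<in> {1..M}"
      let ?S = "\<Sum>e | e \<in> {1..M} \<and> d * e \<in> {D<..M}. 1 / real e ^ 2"
      show "?t d / real d ^ 2 * ?S \<le> (if d \<le> D then 2 / real D * (?t d / real d) else 2 * (?t d / real d ^ 2))"
      proof (cases "d \<le> D")
        case True
        have F: "D div d \<ge> 1" using True d by (simp add: Suc_le_eq div_greater_zero_iff)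
        have "?S \<le> (\<Sum>e\<in>{D div d<..M}. 1 / real e ^ 2)"
          using d by (intro sum_mono2) (auto simp: div_less_iff_less_mult mult.commute)
        also have "\<dots> \<le> 1 / real (D div d)" by (rule sum_inverse_squares_le[OF F])
        \<comment> \<open>Since \<open>D div d \<ge> 1\<close>, rounding \<open>D / d\<close> down
          loses at most a factor 2.\<close>
        also have "\<dots> \<le> 2 * real d / real D"
        proof -
          have "D < d * (D div d + 1)" using d by (simp add: dividend_less_times_div)
          also have "\<dots> \<le> d * (2 * (D div d))" using F by (intro mult_le_mono2) simp
          finally have "real D \<le> 2 * real d * real (D div d)"
            by (metis (mono_tags, lifting) less_imp_le_nat mult.left_commute mult.assoc of_nat_le_iff of_nat_mult of_nat_numeral)
          then show ?thesis using F D by (simp add: field_simps)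
        qed
        finally have "?t d / real d ^ 2 * ?S \<le> ?t d / real d ^ 2 * (2 * real d / real D)"
          by (intro mult_left_mono) auto
        also have "\<dots> = 2 / real D * (?t d / real d)"
          using d by (simp add: power2_eq_square ac_simps)
        finally show ?thesis using True by simp
      next
        case False
        have eq: "{1..M} = insert 1 {1<..M}" using d by auto
        have "?S \<le> (\<Sum>e\<in>{1..M}. 1 / real e ^ 2)"
          by (intro sum_mono2) auto
        also have "\<dots> \<le> 2"
          unfolding eq using sum_inverse_squares_le[of 1 M] by simp
        finally have "?t d / real d ^ 2 * ?S \<le> ?t d / real d ^ 2 * 2"
          by (intro mult_left_mono) auto
        then show ?thesis using False by (simp add: mult.commute)
      qed
    qed
    also have "\<dots> = 2 / real D * (\<Sum>d | d \<in> {1..M} \<and> d \<le> D. ?t d / real d) + 2 * (\<Sum>d | d \<in> {1..M} \<and> \<not> d \<le> D. ?t d / real d ^ 2)"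
      by (simp add: sum.If_cases Int_def sum_distrib_left)
    also have "(\<Sum>d | d \<in> {1..M} \<and> d \<le> D. ?t d / real d) \<le> (\<Sum>d\<in>{1..D}. ?t d / real d)"
      by (intro sum_mono2) auto
    also have "\<dots> \<le> (1 + ln (real D)) ^ Suc k" by (rule sum_tau_div_le[OF D])
    also have "{d. d \<in> {1..M} \<and> \<not> d \<le> D} = {D<..M}" using D by auto
    also have "(\<Sum>d\<in>{D<..M}. ?t d / real d ^ 2) \<le> C * (1 + ln (real D)) ^ k / real D"
      by (rule C(2)[OF D])
    \<comment> \<open>This range has a logarithm to spare; it is inserted so that both ranges carry
      the same power.\<close>
    also have "\<dots> \<le> C * (1 + ln (real D)) ^ Suc k / real D"
      using C(1) D by (intro divide_right_mono mult_left_mono power_increasing) auto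
    finally show ?thesis
      by (simp add: add_divide_distrib distrib_right mult.assoc divide_right_mono del: power_Suc)
  qed
  then show ?case using C(1) by (intro exI[of _ "2 + 2 * C"]) auto
qed


subsection \<open>Smooth numbers\<close>

text \<open>The threshold is real because bounds such as \<open>exp (Z / r)\<close> occur later. The
  number 0 is smooth for no \<open>w\<close>.\<close>

definition smooth :: "real \<Rightarrow> nat \<Rightarrow> bool" where
  "smooth w n \<longleftrightarrow> (\<forall>p. prime p \<longrightarrow> p dvd n \<longrightarrow> real p \<le> w)"

lemma smooth_dvd: "smooth w n \<Longrightarrow> d dvd n \<Longrightarrow> smooth w d"
  unfolding smooth_def by (meson dvd_trans)

lemma smooth_mono: "smooth v n \<Longrightarrow> v \<le> w \<Longrightarrow> smooth w n"
  unfolding smooth_def by (metis order_trans)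

text \<open>Expansion of a product of truncated Euler factors: each \<open>n\<close> is the full
  power of the new prime times a cofactor prime to it. Exponents up to \<open>N\<close> suffice
  because \<open>j < p ^ j \<le> n \<le> N\<close>.\<close>

lemma sum_le_euler_product:
  fixes F :: "nat \<Rightarrow> real"
  assumes "finite P" "\<And>p. p \<in> P \<Longrightarrow> prime p"
    and F: "\<And>n. F n \<ge> 0" "F 1 = 1"
      "\<And>p j n. prime p \<Longrightarrow> n > 0 \<Longrightarrow> \<not> p dvd n \<Longrightarrow> F (p ^ j * n) = F (p ^ j) * F n"
  shows "(\<Sum>n | n \<in> {1..N} \<and> (\<forall>p. prime p \<longrightarrow> p dvd n \<longrightarrow> p \<in> P). F n) \<le> (\<Prod>p\<in>P. \<Sum>j\<le>N. F (p ^ j))"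
  using assms(1,2)
proof (induction P rule: finite_induct)
  case empty
  have "n = 1" if "\<forall>p. prime p \<longrightarrow> \<not> p dvd n" for n :: nat
    using that prime_factor_nat by blast
  then have "{n. n \<in> {1..N} \<and> (\<forall>p. prime p \<longrightarrow> p dvd n \<longrightarrow> p \<in> {})} \<subseteq> {1}" by auto
  then have "(\<Sum>n | n \<in> {1..N} \<and> (\<forall>p. prime p \<longrightarrow> p dvd n \<longrightarrow> p \<in> {}). F n) \<le> (\<Sum>n\<in>{1}. F n)"
    by (intro sum_mono2) (auto simp: F)
  then show ?case using F(2) by simp
next
  case (insert p P)
  have p: "prime p" using insert.prems by simp
  then have p1: "p > 1" by (rule prime_gt_1_nat)
  define S where "S = {n. n \<in> {1..N} \<and> (\<forall>q. prime q \<longrightarrow> q dvd n \<longrightarrow> q \<in> P)}"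
  have finS: "finite S" unfolding S_def by simp
  have notdvd: "\<not> p dvd n" if "n \<in> S" for n
    using that p insert.hyps unfolding S_def by auto
  have sub: "{n. n \<in> {1..N} \<and> (\<forall>q. prime q \<longrightarrow> q dvd n \<longrightarrow> q \<in> insert p P)} \<subseteq> (\<lambda>(j, n). p ^ j * n) ` ({..N} \<times> S)"
  proof
    fix n assume n: "n \<in> {n. n \<in> {1..N} \<and> (\<forall>q. prime q \<longrightarrow> q dvd n \<longrightarrow> q \<in> insert p P)}"
    then have n0: "n \<noteq> 0" by auto
    obtain m where m: "n = p ^ multiplicity p n * m" "\<not> p dvd m"
      using multiplicity_decompose'[of n p] n0 p1 by auto
    define j where "j = multiplicity p n"
    have nj: "n = p ^ j * m" using m(1) unfolding j_def .
    have m0: "m > 0" using nj n0 by (cases m) auto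
    have "p ^ j \<le> n" "m \<le> n" using nj m0 p1 by (auto simp: Suc_le_eq)
    moreover have "j < p ^ j" using p1 by (simp add: power_gt_expt)
    ultimately have "j \<le> N" "m \<le> N" using n by auto
    moreover have "q \<in> P" if "prime q" "q dvd m" for q
    proof -
      have "q dvd n" using that(2) nj by simp
      then have "q \<in> insert p P" using n that(1) by blast
      with that(2) m(2) show ?thesis by auto
    qed
    ultimately have "(j, m) \<in> {..N} \<times> S" using m0 unfolding S_def by auto
    then show "n \<in> (\<lambda>(j, n). p ^ j * n) ` ({..N} \<times> S)" using nj by (intro image_eqI[of _ _ "(j, m)"]) auto
  qed
  have "(\<Sum>n | n \<in> {1..N} \<and> (\<forall>q. prime q \<longrightarrow> q dvd n \<longrightarrow> q \<in> insert p P). F n)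
      \<le> sum F ((\<lambda>(j, n). p ^ j * n) ` ({..N} \<times> S))"
    using sub finS by (intro sum_mono2) (auto simp: F)
  also have "\<dots> \<le> sum (F \<circ> (\<lambda>(j, n). p ^ j * n)) ({..N} \<times> S)"
    using finS by (intro sum_image_le) (auto simp: F)
  also have "\<dots> = (\<Sum>(j, n)\<in>{..N} \<times> S. F (p ^ j) * F n)"
    using F(3)[OF p] notdvd by (intro sum.cong) (auto simp: S_def)
  also have "\<dots> = (\<Sum>j\<le>N. F (p ^ j)) * (\<Sum>n\<in>S. F n)"
    by (simp add: sum_product sum.cartesian_product)
  also have "\<dots> \<le> (\<Sum>j\<le>N. F (p ^ j)) * (\<Prod>p\<in>P. \<Sum>j\<le>N. F (p ^ j))"
    unfolding S_def using insert.prems by (intro mult_left_mono insert.IH sum_nonneg F) auto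
  finally show ?case using insert.hyps by simp
qed

lemma finite_primes_le: "finite {p :: nat. prime p \<and> real p \<le> w}"
  by (rule finite_subset[of _ "{..nat \<lfloor>w\<rfloor>}"]) (auto simp: le_nat_floor)

lemma sum_smooth_le_euler_product:
  fixes F :: "nat \<Rightarrow> real"
  assumes F: "\<And>n. F n \<ge> 0" "F 1 = 1"
      "\<And>p j n. prime p \<Longrightarrow> n > 0 \<Longrightarrow> \<not> p dvd n \<Longrightarrow> F (p ^ j * n) = F (p ^ j) * F n"
  shows "(\<Sum>n | n \<in> {1..N} \<and> smooth w n. F n) \<le> (\<Prod>p | prime p \<and> real p \<le> w. \<Sum>j\<le>N. F (p ^ j))"
proof -
  have eq: "{n. n \<in> {1..N} \<and> smooth w n} = {n. n \<in> {1..N} \<and> (\<forall>p. prime p \<longrightarrow> p dvd n \<longrightarrow> p \<in> {p. prime p \<and> real p \<le> w})}"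
    by (auto simp: smooth_def)
  show ?thesis unfolding eq
    by (intro sum_le_euler_product finite_primes_le F) auto
qed

section \<open>Counting smooth numbers by Rankin's trick\<close>

lemma sum_geometric_le:
  fixes r :: real
  assumes "0 \<le> r" "r < 1"
  shows "(\<Sum>j\<le>N. r ^ j) \<le> 1 / (1 - r)"
  using assms by (simp add: sum_gp0 divide_right_mono)

text \<open>Each \<open>n \<le> N\<close> is counted with weight \<open>(N / n) powr \<eta>\<close>,
  which is at least 1. The sum of \<open>n powr (-\<eta>)\<close> over \<open>w\<close>-smooth
  numbers is at most a finite product of geometric series, independent of \<open>N\<close>.\<close>

lemma card_smooth_le:
  assumes "\<eta> > 0"
  shows "\<exists>C\<ge>0. \<forall>N. real (card {n. n \<in> {1..N} \<and> smooth w n}) \<le> C * real N powr \<eta>"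
proof -
  define C where "C = (\<Prod>p | prime p \<and> real p \<le> w. 1 / (1 - real p powr (-\<eta>)))"
  have lt1: "real p powr (-\<eta>) < 1" if "prime p" for p
  proof -
    have "p > 1" using that by (rule prime_gt_1_nat)
    then show ?thesis using powr_less_mono[of "-\<eta>" 0 "real p"] assms by simp
  qed
  have "real (card {n. n \<in> {1..N} \<and> smooth w n}) \<le> C * real N powr \<eta>" for N
  proof -
    have "real (card {n. n \<in> {1..N} \<and> smooth w n}) = (\<Sum>n | n \<in> {1..N} \<and> smooth w n. 1)" by simp
    also have "\<dots> \<le> (\<Sum>n | n \<in> {1..N} \<and> smooth w n. real N powr \<eta> * real n powr (-\<eta>))"
    proof (rule sum_mono)
      fix n assume n: "n \<in> {n. n \<in> {1..N} \<and> smooth w n}"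
      then have "real n powr \<eta> \<le> real N powr \<eta>" using assms by (intro powr_mono2) auto
      then show "1 \<le> real N powr \<eta> * real n powr (-\<eta>)"
        using n by (simp add: powr_minus field_simps)
    qed
    also have "\<dots> = real N powr \<eta> * (\<Sum>n | n \<in> {1..N} \<and> smooth w n. real n powr (-\<eta>))"
      by (rule sum_distrib_left[symmetric])
    also have "(\<Sum>n | n \<in> {1..N} \<and> smooth w n. real n powr (-\<eta>)) \<le> (\<Prod>p | prime p \<and> real p \<le> w. \<Sum>j\<le>N. real (p ^ j) powr (-\<eta>))"
      by (intro sum_smooth_le_euler_product) (auto simp: powr_mult)
    also have "\<dots> \<le> C"
      unfolding C_def
    proof (intro prod_mono conjI sum_nonneg)
      fix p assume "p \<in> {p. prime p \<and> real p \<le> w}"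
      then have p: "prime p" by simp
      have "(\<Sum>j\<le>N. real (p ^ j) powr (-\<eta>)) = (\<Sum>j\<le>N. (real p powr (-\<eta>)) ^ j)"
        using prime_gt_0_nat[OF p] by (intro sum.cong) (auto simp: powr_powr powr_realpow[symmetric] mult.commute)
      also have "\<dots> \<le> 1 / (1 - real p powr (-\<eta>))"
        using lt1[OF p] by (intro sum_geometric_le) auto
      finally show "(\<Sum>j\<le>N. real (p ^ j) powr (-\<eta>)) \<le> 1 / (1 - real p powr (-\<eta>))" .
    qed auto
    finally show ?thesis by (simp add: mult.commute mult_right_mono)
  qed
  moreover have "C \<ge> 0"
    unfolding C_def using lt1 by (intro prod_nonneg) (auto simp: less_imp_le)
  ultimately show ?thesis by blast
qed

text \<open>The prime factors of \<open>n\<close> are sorted, with multiplicity, by whether they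
  exceed \<open>w\<close>.\<close>

lemma smooth_rough_factorisation:
  assumes "n > 0"
  shows "\<exists>a b. n = a * b \<and> smooth w a \<and> (\<forall>p. prime p \<longrightarrow> p dvd b \<longrightarrow> w < real p)"
  using assms
proof (induction n rule: prime_divisors_induct)
  case zero
  then show ?case by simp
next
  case (unit n)
  then show ?case by (intro exI[of _ 1]) (auto simp: smooth_def)
next
  case (factor p n)
  then obtain a b where ab: "n = a * b" "smooth w a" "\<And>q. prime q \<Longrightarrow> q dvd b \<Longrightarrow> w < real q" by auto
  show ?case
  proof (cases "real p \<le> w")
    case True
    have "smooth w (p * a)"
      unfolding smooth_def
    proof (intro allI impI)
      fix q :: nat assume q: "prime q" "q dvd p * a"
      then have "q = p \<or> q dvd a"
        using factor.hyps by (metis prime_dvd_mult_iff primes_dvd_imp_eq)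
      then show "real q \<le> w" using True ab(2) q(1) by (auto simp: smooth_def)
    qed
    then show ?thesis using ab by (intro exI[of _ "p * a"] exI[of _ b]) auto
  next
    case False
    have "w < real q" if q: "prime q" "q dvd p * b" for q
    proof -
      have "q = p \<or> q dvd b"
        using factor.hyps q by (metis prime_dvd_mult_iff primes_dvd_imp_eq)
      then show ?thesis using False ab(3) q(1) by auto
    qed
    then show ?thesis using ab by (intro exI[of _ a] exI[of _ "p * b"]) auto
  qed
qed

section \<open>Pointwise bounds for the divisor function\<close>

lemma tau_le_power_card_divisors:
  assumes "n > 0"
  shows "tau m n \<le> card {d. d dvd n} ^ m"
proof -
  have "tau m n \<le> card {ds. set ds \<subseteq> {d. d dvd n} \<and> length ds = m}"
    unfolding tau_def using assms prod_list_dvd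
    by (intro card_mono finite_lists_length_eq) auto
  also have "\<dots> = card {d. d dvd n} ^ m"
    using assms by (intro card_lists_length_eq) auto
  finally show ?thesis .
qed

text \<open>Split \<open>n = a * b\<close> at a constant \<open>w\<close>. The rough part
  \<open>b\<close> costs at most \<open>n powr (\<epsilon> / 2)\<close> because its primes are
  large. The divisors of \<open>a\<close> are \<open>w\<close>-smooth, hence few, which accounts for
  the other half of the exponent.\<close>

lemma tau_le_powr:
  assumes "\<epsilon> > 0" "m \<ge> 1"
  shows "\<exists>C\<ge>0. \<forall>n\<ge>1. real (tau m n) \<le> C * real n powr \<epsilon>"
proof -
  \<comment> \<open>This makes \<open>ln m / ln w\<close> at most \<open>\<epsilon> / 2\<close>; the
    added 1 keeps \<open>ln w\<close> positive for \<open>m = 1\<close>. In \<open>\<eta>\<close>,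
    the division by \<open>m\<close> is there because the divisor count enters to the power
    \<open>m\<close>.\<close>
  define w where "w = exp (2 * (ln (real m) + 1) / \<epsilon>)"
  define \<eta> where "\<eta> = \<epsilon> / (2 * real m)"
  have lnm: "ln (real m) \<ge> 0" using assms by simp
  have lnw: "ln w = 2 * (ln (real m) + 1) / \<epsilon>" by (simp add: w_def)
  have "ln w > 0" unfolding lnw using assms(1) lnm by (simp add: add_nonneg_pos)
  then have w1: "w > 1" by (simp add: w_def)
  have "\<eta> > 0" unfolding \<eta>_def using assms by auto
  then obtain C where C: "C \<ge> 0" "\<And>N. real (card {n. n \<in> {1..N} \<and> smooth w n}) \<le> C * real N powr \<eta>"
    using card_smooth_le[OF \<open>\<eta> > 0\<close>, of w] by auto
  have "real (tau m n) \<le> C ^ m * real n powr \<epsilon>" if n: "n \<ge> 1" for n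
  proof -
    obtain a b where ab: "n = a * b" "smooth w a" "\<And>p. prime p \<Longrightarrow> p dvd b \<Longrightarrow> w < real p"
      using smooth_rough_factorisation[of n w] n by auto
    then have pos: "a > 0" "b > 0" using n by (auto intro!: Nat.gr0I)
    have le: "a \<le> n" "b \<le> n" using ab(1) pos by auto
    have "real (tau m n) \<le> real (tau m a) * real b powr (ln (real m) / ln w)"
      unfolding ab(1) using ab(3) w1 pos assms by (intro tau_mult_rough_le) (auto intro: less_imp_le)
    also have "real b powr (ln (real m) / ln w) \<le> real n powr (\<epsilon> / 2)"
    proof -
      have "ln (real m) / ln w \<le> \<epsilon> / 2" 
      proof -
        have "\<epsilon> / 2 * ln w = ln (real m) + 1" unfolding lnw using assms(1) by simp
        then show ?thesis using \<open>ln w > 0\<close> by (simp add: pos_divide_le_eq)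
      qed
      moreover have "0 \<le> ln (real m) / ln w" using lnm \<open>ln w > 0\<close> by simp
      ultimately show ?thesis using le pos by (intro powr_mono_both) auto
    qed
    also have "real (tau m a) \<le> (C * real n powr \<eta>) ^ m"
    proof -
      have "d \<in> {1..a} \<and> smooth w d" if "d dvd a" for d
        using that pos(1) ab(2) dvd_imp_le[OF that] dvd_pos_nat[OF pos(1) that] smooth_dvd[OF ab(2) that] by simp
      then have "card {d. d dvd a} \<le> card {n. n \<in> {1..a} \<and> smooth w n}"
        by (intro card_mono) auto
      then have "real (card {d. d dvd a}) \<le> C * real a powr \<eta>"
        using C(2)[of a] by linarith
      also have "\<dots> \<le> C * real n powr \<eta>"
        using le \<open>\<eta> > 0\<close> C(1) by (intro mult_left_mono powr_mono2) auto
      finally have "real (card {d. d dvd a}) ^ m \<le> (C * real n powr \<eta>) ^ m"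
        by (intro power_mono) auto
      moreover have "real (tau m a) \<le> real (card {d. d dvd a}) ^ m"
        using tau_le_power_card_divisors[OF pos(1), of m] by (simp flip: of_nat_power)
      ultimately show ?thesis by linarith
    qed
    also have "(C * real n powr \<eta>) ^ m * real n powr (\<epsilon> / 2) = C ^ m * real n powr \<epsilon>"
    proof -
      have "(real n powr \<eta>) ^ m = real n powr (\<epsilon> / 2)"
        using n assms by (simp add: powr_realpow[symmetric] powr_powr \<eta>_def)
      then show ?thesis by (simp add: power_mult_distrib powr_add[symmetric])
    qed
    finally show ?thesis by (simp add: mult_right_mono mult_left_mono)
  qed
  then show ?thesis using C(1) by (intro exI[of _ "C ^ m"] conjI allI impI zero_le_power)
qed

subsection \<open>Primes in dyadic intervals\<close>

lemma prod_primes_dvd: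
  fixes n :: nat
  assumes "finite A" "\<And>p. p \<in> A \<Longrightarrow> prime p \<and> p dvd n"
  shows "\<Prod>A dvd n"
  using assms
proof (induction A rule: finite_induct)
  case empty
  then show ?case by simp
next
  case (insert p A)
  have "coprime p (\<Prod>A)"
    using insert by (intro prod_coprime_right) (auto intro!: primes_coprime)
  then show ?case using insert by (simp add: divides_mult)
qed

text \<open>Chebyshev's argument: every prime in the range divides the central binomial coefficient,
  which is at most \<open>2 ^ (2 * n)\<close>.\<close>

lemma sum_ln_primes_le:
  "(\<Sum>p | prime p \<and> n < p \<and> p \<le> 2 * n. ln (real p)) \<le> 2 * real n * ln 2"
proof -
  let ?A = "{p. prime p \<and> n < p \<and> p \<le> 2 * n}"
  have fin: "finite ?A" by simp
  have "p dvd (2 * n choose n)" if "p \<in> ?A" for p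
  proof -
    have p: "prime p" "n < p" "p \<le> 2 * n" using that by auto
    have "fact n * fact (2 * n - n) * (2 * n choose n) = (fact (2 * n) :: nat)"
      by (rule binomial_fact_lemma) simp
    moreover have "p dvd (fact (2 * n) :: nat)" using p by (simp add: prime_dvd_fact_iff)
    moreover have "\<not> p dvd (fact n :: nat)" using p by (simp add: prime_dvd_fact_iff)
    ultimately show ?thesis using p(1) by (metis add_diff_cancel_left' mult_2 prime_dvd_mult_iff)
  qed
  then have "\<Prod>?A dvd (2 * n choose n)" using fin by (intro prod_primes_dvd) auto
  then have "\<Prod>?A \<le> (2 * n choose n)" by (rule dvd_imp_le) simp
  also have "\<dots> \<le> 2 ^ (2 * n)" by (rule binomial_le_pow2)
  finally have "real (\<Prod>?A) \<le> 2 ^ (2 * n)" by (metis of_nat_le_iff of_nat_numeral of_nat_power)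
  moreover have "real (\<Prod>?A) > 0" by (auto intro!: prod_pos simp: prime_gt_0_nat)
  ultimately have "ln (real (\<Prod>?A)) \<le> ln (2 ^ (2 * n))" by (subst ln_le_cancel_iff) auto
  also have "\<dots> = 2 * real n * ln 2" by (simp add: ln_realpow)
  also have "ln (real (\<Prod>?A)) = (\<Sum>p\<in>?A. ln (real p))"
    unfolding of_nat_prod using fin by (intro ln_prod) (auto simp: prime_gt_0_nat)
  finally show ?thesis .
qed

text \<open>By the Chebyshev bound, each further dyadic block adds at most
  \<open>2 * ln 2\<close>.\<close>

lemma sum_ln_div_primes_le_pow2:
  "(\<Sum>p | prime p \<and> p \<le> 2 ^ k. ln (real p) / real p) \<le> 2 * real k * ln 2"
proof (induction k)
  case 0
  have eq: "{p :: nat. prime p \<and> p \<le> 2 ^ 0} = {}" by (auto dest: prime_gt_1_nat)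
  show ?case unfolding eq by simp
next
  case (Suc k)
  let ?A = "\<lambda>n. {p :: nat. prime p \<and> p \<le> n}"
  let ?B = "{p :: nat. prime p \<and> 2 ^ k < p \<and> p \<le> 2 * 2 ^ k}"
  have eq: "?A (2 ^ Suc k) = ?A (2 ^ k) \<union> ?B" by auto
  have "(\<Sum>p\<in>?B. ln (real p) / real p) \<le> (\<Sum>p\<in>?B. ln (real p) / 2 ^ k)"
  proof (rule sum_mono)
    fix p assume "p \<in> ?B"
    then have p: "2 ^ k < p" by simp
    then have "real (2 ^ k) < real p" unfolding of_nat_less_iff .
    with p show "ln (real p) / real p \<le> ln (real p) / 2 ^ k"
      by (intro divide_left_mono) auto
  qed
  also have "\<dots> = (\<Sum>p\<in>?B. ln (real p)) / 2 ^ k" by (rule sum_divide_distrib[symmetric])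
  also have "\<dots> \<le> 2 * ln 2"
    using sum_ln_primes_le[of "2 ^ k"] by (simp add: field_simps)
  finally have "(\<Sum>p\<in>?A (2 ^ k). ln (real p) / real p) + (\<Sum>p\<in>?B. ln (real p) / real p) \<le> 2 * real (Suc k) * ln 2"
    using Suc.IH by (simp add: algebra_simps)
  moreover have "(\<Sum>p\<in>?A (2 ^ Suc k). ln (real p) / real p) = (\<Sum>p\<in>?A (2 ^ k). ln (real p) / real p) + (\<Sum>p\<in>?B. ln (real p) / real p)"
    unfolding eq by (intro sum.union_disjoint) auto
  ultimately show ?case by simp
qed

text \<open>An upper bound of Mertens type. Rounding \<open>w\<close> up to a power of 2 accounts
  for the additive constant.\<close>

lemma sum_ln_div_primes_le:
  assumes "w \<ge> 1"
  shows "(\<Sum>p | prime p \<and> real p \<le> w. ln (real p) / real p) \<le> 2 * ln w + 2 * ln 2"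
proof -
  define k where "k = nat \<lceil>log 2 w\<rceil>"
  have l0: "log 2 w \<ge> 0" using assms by simp
  have k: "log 2 w \<le> real k" "real k \<le> log 2 w + 1" unfolding k_def using l0 by linarith+
  have "w = 2 powr log 2 w" using assms by simp
  also have "\<dots> \<le> 2 powr real k" using k(1) by (intro powr_mono) auto
  finally have w: "w \<le> 2 ^ k" by (simp add: powr_realpow)
  have "p \<le> 2 ^ k" if "real p \<le> w" for p :: nat
  proof -
    have "real p \<le> 2 ^ k" using that w by linarith
    then show ?thesis by simp
  qed
  then have "(\<Sum>p | prime p \<and> real p \<le> w. ln (real p) / real p) \<le> (\<Sum>p | prime p \<and> p \<le> 2 ^ k. ln (real p) / real p)"
    by (intro sum_mono2) (auto intro!: divide_nonneg_nonneg ln_ge_zero dest: prime_ge_1_nat)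
  also have "\<dots> \<le> 2 * real k * ln 2" by (rule sum_ln_div_primes_le_pow2)
  also have "\<dots> \<le> 2 * (log 2 w + 1) * ln 2" using k(2) by (intro mult_right_mono) auto
  also have "\<dots> = 2 * ln w + 2 * ln 2" by (simp add: log_def algebra_simps)
  finally show ?thesis .
qed


subsection \<open>A Jordan-type totient\<close>

text \<open>The Moebius transform of \<open>n\<^sup>\<alpha>\<close>. For small \<open>\<alpha>\<close> it is small at primes, which is what
  makes the sum in \<open>sum_smooth_jordan_le\<close> bounded.\<close>

definition jordan :: "real \<Rightarrow> nat \<Rightarrow> real" where
  "jordan \<alpha> n = real n powr \<alpha> * (\<Prod>p\<in>prime_factors n. 1 - real p powr (-\<alpha>))"

lemma jordan_nonneg:
  assumes "\<alpha> \<ge> 0"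
  shows "jordan \<alpha> n \<ge> 0"
proof -
  have "real p powr (-\<alpha>) \<le> 1" if "p \<in> prime_factors n" for p
  proof -
    have "prime p" using that by blast
    then have "real p \<ge> 1" using prime_ge_1_nat[of p] by simp
    then show ?thesis using powr_mono[of "-\<alpha>" 0 "real p"] assms by simp
  qed
  then show ?thesis unfolding jordan_def by (intro mult_nonneg_nonneg prod_nonneg) auto
qed

lemma jordan_1: "jordan \<alpha> 1 = 1"
  by (simp add: jordan_def)

lemma jordan_prime_power:
  assumes "prime p"
  shows "jordan \<alpha> (p ^ Suc j) = (real p powr \<alpha>) ^ Suc j * (1 - real p powr (-\<alpha>))"
proof -
  have p0: "p > 0" using assms prime_gt_0_nat by blast
  have "prime_factors (p ^ Suc j) = {p}"
    using assms p0 by (auto simp: in_prime_factors_iff prime_dvd_power_iff primes_dvd_imp_eq simp del: power_Suc)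
  moreover have "real (p ^ Suc j) powr \<alpha> = (real p powr \<alpha>) ^ Suc j"
    using p0 by (simp add: powr_realpow[symmetric] powr_powr mult.commute del: power_Suc)
  ultimately show ?thesis unfolding jordan_def by simp
qed

lemma jordan_mult:
  assumes "prime p" "n > 0" "\<not> p dvd n"
  shows "jordan \<alpha> (p ^ j * n) = jordan \<alpha> (p ^ j) * jordan \<alpha> n"
proof -
  have p0: "p \<noteq> 0" using assms by auto
  have "q = p" if "q \<in> prime_factors (p ^ j)" for q
    using that assms(1) by (metis in_prime_factors_iff prime_dvd_power primes_dvd_imp_eq)
  then have "prime_factors (p ^ j) \<inter> prime_factors n = {}"
    using assms(3) by blast
  then have "(\<Prod>q\<in>prime_factors (p ^ j * n). 1 - real q powr (-\<alpha>))
      = (\<Prod>q\<in>prime_factors (p ^ j). 1 - real q powr (-\<alpha>)) * (\<Prod>q\<in>prime_factors n. 1 - real q powr (-\<alpha>))"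
    using p0 assms(2) by (subst prime_factors_product) (auto intro!: prod.union_disjoint)
  then show ?thesis by (simp add: jordan_def powr_mult)
qed

text \<open>Telescoping: for \<open>j > 0\<close> the value at \<open>p ^ j\<close> is the
  difference of the \<open>\<alpha>\<close>-th powers of \<open>p ^ j\<close> and
  \<open>p ^ (j - 1)\<close>.\<close>

lemma sum_jordan_prime_powers:
  assumes "prime p"
  shows "(\<Sum>j\<le>k. jordan \<alpha> (p ^ j)) = real (p ^ k) powr \<alpha>"
proof (induction k)
  case 0
  then show ?case using jordan_1 by simp
next
  case (Suc k)
  have p0: "p > 0" using assms prime_gt_0_nat by blast
  have pw: "real (p ^ i) powr \<alpha> = (real p powr \<alpha>) ^ i" for i
    using p0 by (simp add: powr_realpow[symmetric] powr_powr mult.commute)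
  have "real p powr \<alpha> * real p powr (-\<alpha>) = 1"
    using p0 by (simp add: powr_minus)
  then show ?case
    unfolding sum.atMost_Suc Suc.IH jordan_prime_power[OF assms] pw by (simp add: algebra_simps)
qed

text \<open>The direction of Moebius inversion used below. After the full power \<open>p ^ k\<close>
  of a prime is split off, the products \<open>p ^ j * d\<close> with \<open>j \<le> k\<close> and
  \<open>d dvd m\<close> are distinct divisors of \<open>n\<close>, and any others contribute
  non-negative terms.\<close>

lemma powr_le_sum_jordan:
  assumes "\<alpha> \<ge> 0" "n > 0"
  shows "real n powr \<alpha> \<le> (\<Sum>d | d dvd n. jordan \<alpha> d)"
  using assms(2)
proof (induction n rule: less_induct)
  case (less n)
  show ?case
  proof (cases "n = 1")
    case True
    then show ?thesis using jordan_1[of \<alpha>] by simp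
  next
    case False
    then obtain p where p: "prime p" "p dvd n" using prime_factor_nat by blast
    have p1: "p > 1" using p(1) by (rule prime_gt_1_nat)
    obtain m where m: "n = p ^ multiplicity p n * m" "\<not> p dvd m"
      using multiplicity_decompose'[of n p] less.prems p1 by auto
    define k where "k = multiplicity p n"
    have nk: "n = p ^ k * m" using m(1) unfolding k_def .
    have m0: "m > 0" using nk less.prems by (cases m) auto
    have "k \<noteq> 0" using nk m(2) p(2) by (metis mult_1 power_0)
    then have "1 < p ^ k" using p1 by (intro one_less_power) auto
    then have mn: "m < n" using nk m0 by simp
    let ?A = "{..k} \<times> {d. d dvd m}"
    let ?f = "\<lambda>(j, d). p ^ j * d"
    have pd: "\<not> p dvd d" "d > 0" if "d dvd m" for d
      using that m(2) m0 by (auto intro: dvd_trans dvd_pos_nat)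
    have inj: "inj_on ?f ?A"
    proof (rule inj_onI)
      fix a b assume "a \<in> ?A" "b \<in> ?A" and eq: "?f a = ?f b"
      then obtain i d j e where a: "a = (i, d)" "d dvd m" and b: "b = (j, e)" "e dvd m" by auto
      have "multiplicity p (p ^ i * d) = i" "multiplicity p (p ^ j * e) = j"
        using pd a(2) b(2) p(1) by (auto intro!: multiplicity_eqI simp: mult.commute)
      then have "i = j" using eq a b by simp
      moreover from this have "d = e" using eq a b p1 by simp
      ultimately show "a = b" using a b by simp
    qed
    have "real n powr \<alpha> = real (p ^ k) powr \<alpha> * real m powr \<alpha>"
      unfolding nk by (simp add: powr_mult)
    also have "\<dots> \<le> (\<Sum>j\<le>k. jordan \<alpha> (p ^ j)) * (\<Sum>d | d dvd m. jordan \<alpha> d)"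
      unfolding sum_jordan_prime_powers[OF p(1)] by (intro mult_left_mono less.IH mn m0) auto
    also have "\<dots> = (\<Sum>(j, d)\<in>?A. jordan \<alpha> (p ^ j) * jordan \<alpha> d)"
      by (simp add: sum_product sum.cartesian_product)
    also have "\<dots> = (\<Sum>a\<in>?A. jordan \<alpha> (?f a))"
      using pd by (intro sum.cong) (auto simp: jordan_mult[OF p(1)])
    also have "\<dots> = sum (jordan \<alpha>) (?f ` ?A)"
      using inj by (simp add: sum.reindex)
    also have "\<dots> \<le> (\<Sum>d | d dvd n. jordan \<alpha> d)"
    proof (rule sum_mono2)
      show "finite {d. d dvd n}" using less.prems by simp
      show "?f ` ?A \<subseteq> {d. d dvd n}"
        unfolding nk by (auto intro!: mult_dvd_mono le_imp_power_dvd)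
    qed (use assms jordan_nonneg in auto)
    finally show ?thesis .
  qed
qed

text \<open>The bound depends on \<open>\<kappa>\<close> alone. The Euler factor at \<open>p\<close>
  exceeds 1 by at most a constant times \<open>(p powr \<alpha> - 1) / p\<close>, and
  \<open>p powr \<alpha> - 1 \<le> exp \<kappa> * \<alpha> * ln p\<close> as long as
  \<open>\<alpha> * ln p \<le> \<kappa>\<close>. The Mertens type bound then controls the sum over
  \<open>p\<close>.\<close>

lemma sum_smooth_jordan_le:
  assumes "0 \<le> \<alpha>" "\<alpha> \<le> 1/2" "w \<ge> 1" "\<alpha> * ln w \<le> \<kappa>"
  shows "(\<Sum>n | n \<in> {1..N} \<and> smooth w n. jordan \<alpha> n / real n) \<le> exp (4 * exp \<kappa> * (2 * \<kappa> + 1))"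
proof -
  have k0: "\<kappa> \<ge> 0" using assms by (smt (verit) ln_ge_zero mult_nonneg_nonneg)
  have "(\<Sum>n | n \<in> {1..N} \<and> smooth w n. jordan \<alpha> n / real n)
      \<le> (\<Prod>p | prime p \<and> real p \<le> w. \<Sum>j\<le>N. jordan \<alpha> (p ^ j) / real (p ^ j))"
    using jordan_nonneg[OF assms(1)] jordan_1[of \<alpha>]
    by (intro sum_smooth_le_euler_product) (auto simp: jordan_mult)
  also have "\<dots> \<le> (\<Prod>p | prime p \<and> real p \<le> w. exp (4 * exp \<kappa> * \<alpha> * (ln (real p) / real p)))"
  proof (rule prod_mono, rule conjI)
    fix p assume "p \<in> {p. prime p \<and> real p \<le> w}"
    then have p: "prime p" "real p \<le> w" by auto
    have p2: "real p \<ge> 2" using prime_ge_2_nat[OF p(1)] by simp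
    \<comment> \<open>The ratio of the geometric series at \<open>p\<close>. As
      \<open>\<alpha> \<le> 1/2\<close> and \<open>p \<ge> 2\<close>, it is at most
      \<open>3/4\<close>, whence the factor 4 in the bound.\<close>
    define r where "r = real p powr \<alpha> / real p"
    have r0: "r \<ge> 0" unfolding r_def by simp
    have "r = real p powr (\<alpha> - 1)" unfolding r_def using p2 by (simp add: powr_diff)
    also have "\<dots> \<le> real p powr (-1/2)" using assms p2 by (intro powr_mono) auto
    also have "\<dots> \<le> 2 powr (-1/2)" using p2 by (intro powr_mono2') auto
    also have "\<dots> \<le> 3/4"
    proof -
      have "(4/3 :: real) \<le> sqrt 2" by (rule real_le_rsqrt) (simp add: power2_eq_square)
      then have "1 / sqrt 2 \<le> 1 / (4/3 :: real)" by (intro divide_left_mono) auto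
      moreover have "2 powr (-1/2) = 1 / sqrt (2::real)"
        using powr_minus[of "2::real" "1/2"] by (simp add: powr_half_sqrt field_simps)
      ultimately show ?thesis by simp
    qed
    finally have r34: "r \<le> 3/4" .
    have le1: "real p powr (-\<alpha>) \<le> 1" using powr_mono[of "-\<alpha>" 0 "real p"] p2 assms(1) by simp
    have "jordan \<alpha> (p ^ j) / real (p ^ j) = (if j = 0 then 1 else (1 - real p powr (-\<alpha>)) * r ^ j)" for j
    proof (cases j)
      case 0
      then show ?thesis using jordan_1[of \<alpha>] by simp
    next
      case (Suc i)
      then show ?thesis unfolding Suc jordan_prime_power[OF p(1)] r_def
        by (simp add: power_divide del: power_Suc)
    qed
    then have "(\<Sum>j\<le>N. jordan \<alpha> (p ^ j) / real (p ^ j)) = (\<Sum>j\<le>N. if j = 0 then 1 else (1 - real p powr (-\<alpha>)) * r ^ j)"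
      by (intro sum.cong) auto
    also have "\<dots> = 1 + (\<Sum>j<N. (1 - real p powr (-\<alpha>)) * r ^ Suc j)"
      by (subst sum.atMost_shift) simp
    also have "(\<Sum>j<N. (1 - real p powr (-\<alpha>)) * r ^ Suc j) = (1 - real p powr (-\<alpha>)) * r * (\<Sum>j<N. r ^ j)"
      by (simp add: sum_distrib_left mult.assoc)
    also have "(\<Sum>j<N. r ^ j) \<le> (\<Sum>j\<le>N. r ^ j)" using r0 by (intro sum_mono2) auto
    also have "(\<Sum>j\<le>N. r ^ j) \<le> 1 / (1 - r)" using r0 r34 by (intro sum_geometric_le) auto
    also have "1 / (1 - r) \<le> 4" using r34 by (simp add: field_simps)
    finally have sum_le: "(\<Sum>j\<le>N. jordan \<alpha> (p ^ j) / real (p ^ j)) \<le> 1 + (1 - real p powr (-\<alpha>)) * r * 4"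
      using le1 r0 by (simp add: mult_left_mono)
    have pa: "real p powr \<alpha> = exp (\<alpha> * ln (real p))" using p2 by (simp add: powr_def)
    have "(1 - real p powr (-\<alpha>)) * r = (real p powr \<alpha> - 1) / real p"
      unfolding r_def using p2 by (simp add: powr_minus field_simps)
    also have "\<dots> \<le> exp \<kappa> * \<alpha> * (ln (real p) / real p)"
    proof -
      let ?t = "\<alpha> * ln (real p)"
      have t0: "?t \<ge> 0" using assms p2 by simp
      have "?t \<le> \<alpha> * ln w" using assms p p2 by (intro mult_left_mono) auto
      then have tk: "?t \<le> \<kappa>" using assms by linarith
      \<comment> \<open>Multiplied by \<open>exp ?t\<close>, this becomes
        \<open>exp ?t - 1 \<le> exp ?t * ?t\<close>.\<close>
      have "1 - ?t \<le> exp (- ?t)" using exp_ge_add_one_self[of "- ?t"] by simp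
      then have "exp ?t * (1 - ?t) \<le> exp ?t * exp (- ?t)" by (intro mult_left_mono) auto
      then have "exp ?t - 1 \<le> exp ?t * ?t" by (simp add: exp_minus algebra_simps)
      also have "\<dots> \<le> exp \<kappa> * ?t" using tk t0 by (intro mult_right_mono) auto
      finally have "(real p powr \<alpha> - 1) / real p \<le> exp \<kappa> * ?t / real p"
        unfolding pa using p2 by (intro divide_right_mono) auto
      then show ?thesis by (simp add: mult.assoc)
    qed
    finally have "(\<Sum>j\<le>N. jordan \<alpha> (p ^ j) / real (p ^ j)) \<le> 1 + 4 * exp \<kappa> * \<alpha> * (ln (real p) / real p)"
      using sum_le by simp
    also have "\<dots> \<le> exp (4 * exp \<kappa> * \<alpha> * (ln (real p) / real p))"
      by (rule exp_ge_add_one_self)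
    finally show "(\<Sum>j\<le>N. jordan \<alpha> (p ^ j) / real (p ^ j)) \<le> exp (4 * exp \<kappa> * \<alpha> * (ln (real p) / real p))" .
    show "0 \<le> (\<Sum>j\<le>N. jordan \<alpha> (p ^ j) / real (p ^ j))"
      using jordan_nonneg[OF assms(1)] by (intro sum_nonneg) auto
  qed
  also have "\<dots> = exp (4 * exp \<kappa> * \<alpha> * (\<Sum>p | prime p \<and> real p \<le> w. ln (real p) / real p))"
    using finite_primes_le[of w] by (simp add: exp_sum sum_distrib_left)
  also have "\<dots> \<le> exp (4 * exp \<kappa> * (2 * \<kappa> + 1))"
  proof -
    have "\<alpha> * (\<Sum>p | prime p \<and> real p \<le> w. ln (real p) / real p) \<le> \<alpha> * (2 * ln w + 2 * ln 2)"
      using sum_ln_div_primes_le[OF assms(3)] assms(1) by (intro mult_left_mono) auto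
    also have "\<dots> = 2 * (\<alpha> * ln w) + 2 * (\<alpha> * ln 2)" by (simp add: algebra_simps)
    also have "\<alpha> * ln 2 \<le> 1/2 * 1"
      using assms ln_2_less_1 by (intro mult_mono) auto
    finally have "\<alpha> * (\<Sum>p | prime p \<and> real p \<le> w. ln (real p) / real p) \<le> 2 * \<kappa> + 1"
      using assms(4) by linarith
    then show ?thesis by (simp add: mult.assoc)
  qed
  finally show ?thesis .
qed

text \<open>The Rankin weight \<open>n powr \<alpha>\<close> costs only the factor \<open>H\<close>:
  it is expanded over the divisors \<open>d\<close> of \<open>n\<close>, the sum over
  \<open>d\<close> is at most \<open>H\<close>, and the cofactor, allowed to run over all of
  \<open>{1..N}\<close>, gives the single logarithm.\<close>

lemma sum_smooth_powr_le:
  assumes "\<alpha> \<ge> 0" "N \<ge> 1" and H: "(\<Sum>n | n \<in> {1..N} \<and> smooth w n. jordan \<alpha> n / real n) \<le> H"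
  shows "(\<Sum>n | n \<in> {1..N} \<and> smooth w n. real n powr (\<alpha> - 1)) \<le> H * (1 + ln (real N))"
proof -
  let ?A = "{n. n \<in> {1..N} \<and> smooth w n}"
  let ?G = "\<lambda>d e. jordan \<alpha> d / real d * (1 / real e)"
  have G0: "?G d e \<ge> 0" for d e using jordan_nonneg[OF assms(1)] by simp
  have "(\<Sum>n\<in>?A. real n powr (\<alpha> - 1)) \<le> (\<Sum>n\<in>?A. \<Sum>d | d dvd n. ?G d (n div d))"
  proof (rule sum_mono)
    fix n assume "n \<in> ?A"
    then have n: "n > 0" by auto
    have "real n powr (\<alpha> - 1) = real n powr \<alpha> / real n" using n by (simp add: powr_diff)
    also have "\<dots> \<le> (\<Sum>d | d dvd n. jordan \<alpha> d) / real n"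
      using powr_le_sum_jordan[OF assms(1) n] by (intro divide_right_mono) auto
    also have "\<dots> = (\<Sum>d | d dvd n. ?G d (n div d))"
      unfolding sum_divide_distrib using n by (intro sum.cong) (auto simp: field_simps real_of_nat_div)
    finally show "real n powr (\<alpha> - 1) \<le> (\<Sum>d | d dvd n. ?G d (n div d))" .
  qed
  also have "\<dots> = (\<Sum>d\<in>{1..N}. \<Sum>e | e \<in> {1..N} \<and> d * e \<in> ?A. ?G d e)"
    by (rule sum_divisor_sum[where G = ?G]) auto
  also have "\<dots> = (\<Sum>d\<in>?A. \<Sum>e | e \<in> {1..N} \<and> d * e \<in> ?A. ?G d e)"
  proof (rule sum.mono_neutral_right; (intro ballI)?)
    fix d assume d: "d \<in> {1..N} - ?A"
    have False if "e \<in> {1..N}" "d * e \<in> ?A" for e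
      using smooth_dvd[of w "d * e" d] d that by simp
    then have "{e. e \<in> {1..N} \<and> d * e \<in> ?A} = {}" by blast
    then show "(\<Sum>e | e \<in> {1..N} \<and> d * e \<in> ?A. ?G d e) = 0" by (simp only: sum.empty)
  qed auto
  also have "\<dots> \<le> (\<Sum>d\<in>?A. \<Sum>e\<in>{1..N}. ?G d e)"
    using G0 by (intro sum_mono sum_mono2) auto
  also have "\<dots> = (\<Sum>d\<in>?A. jordan \<alpha> d / real d) * (\<Sum>e\<in>{1..N}. 1 / real e)"
    by (simp only: sum_product)
  also have "\<dots> \<le> H * (1 + ln (real N))"
  proof (rule mult_mono)
    have "0 \<le> (\<Sum>d\<in>?A. jordan \<alpha> d / real d)"
      using jordan_nonneg[OF assms(1)] by (intro sum_nonneg) auto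
    then show "0 \<le> H" using H by linarith
  qed (use H sum_inverse_le_ln[OF assms(2)] in \<open>auto intro: sum_nonneg\<close>)
  finally show ?thesis .
qed

subsection \<open>Divisor functions in short intervals\<close>

text \<open>One factor \<open>d\<close> counted by \<open>tau (Suc m) b\<close> is singled out:
  \<open>d powr \<alpha>\<close> is expanded over the divisors \<open>e\<close> of \<open>d\<close>,
  while \<open>c = b div d\<close> keeps \<open>tau m\<close> and its own weight. The index set
  mentions \<open>n\<close> but not \<open>b\<close>, so the bound can be summed over
  \<open>n\<close> even when \<open>b\<close> varies with \<open>n\<close>.\<close>

lemma tau_powr_le_sum_jordan:
  assumes "\<alpha> \<ge> 0" "n > 0" "b dvd n" "b \<le> N" "smooth w b"
  shows "real (tau (Suc m) b) * real b powr \<alpha>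
    \<le> (\<Sum>(e, c) | e \<in> {1..N} \<and> smooth w e \<and> c \<in> {1..N} \<and> smooth w c \<and> e * c \<le> N \<and> e * c dvd n.
        jordan \<alpha> e * (real (tau m c) * real c powr \<alpha>))"
    (is "_ \<le> sum ?F ?R")
proof -
  have b0: "b > 0" using assms(2,3) by (auto intro: dvd_pos_nat)
  let ?g = "\<lambda>c. real (tau m c) * real c powr \<alpha>"
  have g0: "?g c \<ge> 0" for c by simp
  let ?S = "SIGMA d:{d. d dvd b}. {e. e dvd d}"
  have dpos: "d > 0" if "d dvd b" for d using that b0 by (auto intro: dvd_pos_nat)
  have "real (tau (Suc m) b) * real b powr \<alpha> = (\<Sum>d | d dvd b. real (tau m (b div d)) * real b powr \<alpha>)"
    using b0 by (simp add: tau_Suc sum_distrib_right)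
  also have "\<dots> \<le> (\<Sum>d | d dvd b. \<Sum>e | e dvd d. jordan \<alpha> e * ?g (b div d))"
  proof (rule sum_mono)
    fix d assume "d \<in> {d. d dvd b}"
    then have d: "d dvd b" by simp
    have "real b powr \<alpha> = real d powr \<alpha> * real (b div d) powr \<alpha>"
      using d by (simp flip: powr_mult of_nat_mult)
    then have "real (tau m (b div d)) * real b powr \<alpha> = real d powr \<alpha> * ?g (b div d)" by simp
    also have "\<dots> \<le> (\<Sum>e | e dvd d. jordan \<alpha> e) * ?g (b div d)"
      using powr_le_sum_jordan[OF assms(1) dpos[OF d]] by (intro mult_right_mono) auto
    finally show "real (tau m (b div d)) * real b powr \<alpha> \<le> (\<Sum>e | e dvd d. jordan \<alpha> e * ?g (b div d))"
      by (simp add: sum_distrib_right)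
  qed
  also have "\<dots> = (\<Sum>(d, e)\<in>?S. jordan \<alpha> e * ?g (b div d))"
    using b0 dpos by (intro sum.Sigma) auto
  also have "\<dots> = (\<Sum>a\<in>?S. ?F ((\<lambda>(d, e). (e, b div d)) a))"
    by (intro sum.cong) auto
  also have "\<dots> = sum ?F ((\<lambda>(d, e). (e, b div d)) ` ?S)"
  proof (rule sum.reindex[symmetric, unfolded comp_def])
    show "inj_on (\<lambda>(d, e). (e, b div d)) ?S"
    proof (rule inj_onI)
      fix x y assume x: "x \<in> ?S" and y: "y \<in> ?S"
        and eq: "(case x of (d, e) \<Rightarrow> (e, b div d)) = (case y of (d, e) \<Rightarrow> (e, b div d))"
      obtain d e d' e' where xy: "x = (d, e)" "y = (d', e')" by fastforce
      then have "d dvd b" "d' dvd b" "b div d = b div d'" using x y eq by auto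
      then have "d = d'" using b0 by (metis dvd_div_eq_cancel dvd_div_mult_self mult_left_cancel mult_not_zero neq0_conv)
      then show "x = y" using eq xy by simp
    qed
  qed
  also have "\<dots> \<le> sum ?F ?R"
  proof (rule sum_mono2)
    show "finite ?R" by (rule finite_subset[of _ "{1..N} \<times> {1..N}"]) auto
    show "(\<lambda>(d, e). (e, b div d)) ` ?S \<subseteq> ?R"
    proof
      fix x assume "x \<in> (\<lambda>(d, e). (e, b div d)) ` ?S"
      then obtain d e where x: "x = (e, b div d)" "d dvd b" "e dvd d" by auto
      have ecb: "e * (b div d) dvd b"
        using x(2,3) by (metis dvd_mult_div_cancel dvd_refl mult_dvd_mono)
      have sub: "e dvd b" "b div d dvd b" 
        using dvd_trans[OF x(3,2)] dvd_triv_left[of "b div d" d] x(2) by simp_all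
      have "smooth w e" "smooth w (b div d)" using smooth_dvd[OF assms(5)] sub by blast+
      moreover have "e \<le> N" "b div d \<le> N" "e * (b div d) \<le> N"
        using dvd_imp_le[OF sub(1) b0] dvd_imp_le[OF sub(2) b0] dvd_imp_le[OF ecb b0] assms(4) by linarith+
      moreover have "e \<ge> 1" "b div d \<ge> 1"
        using dvd_pos_nat[OF b0 sub(1)] dvd_pos_nat[OF b0 sub(2)] by simp_all
      moreover have "e * (b div d) dvd n" using ecb assms(3) by (rule dvd_trans)
      ultimately show "x \<in> ?R" using x(1) by simp
    qed
    show "0 \<le> ?F x" for x using jordan_nonneg[OF assms(1)] by (cases x) simp
  qed
  finally show ?thesis .
qed

text \<open>After the sums are exchanged, \<open>I\<close> contains at most
  \<open>2 * y / (e * c)\<close> multiples of \<open>e * c\<close>. The sum over \<open>e\<close> is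
  at most \<open>H\<close>, free of logarithms, so only the \<open>m\<close> factors counted by
  \<open>tau m c\<close> contribute them.\<close>

lemma sum_tau_smooth_divisor_le:
  assumes "\<alpha> \<ge> 0" "N \<ge> 1" and H: "(\<Sum>n | n \<in> {1..N} \<and> smooth w n. jordan \<alpha> n / real n) \<le> H"
    and I: "finite I" "0 \<notin> I" "y \<ge> 0"
      "\<And>d. d \<in> {1..N} \<Longrightarrow> real (card {n \<in> I. d dvd n}) \<le> 2 * y / real d"
    and b: "\<And>n. n \<in> I' \<Longrightarrow> b n dvd n \<and> b n \<le> N \<and> smooth w (b n)" and "I' \<subseteq> I"
  shows "(\<Sum>n\<in>I'. real (tau (Suc m) (b n)) * real (b n) powr \<alpha>) \<le> 2 * y * H ^ Suc m * (1 + ln (real N)) ^ m"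
proof -
  let ?A = "{n. n \<in> {1..N} \<and> smooth w n}"
  let ?P = "{(e, c). e \<in> {1..N} \<and> smooth w e \<and> c \<in> {1..N} \<and> smooth w c \<and> e * c \<le> N}"
  let ?R = "\<lambda>n. {(e, c). e \<in> {1..N} \<and> smooth w e \<and> c \<in> {1..N} \<and> smooth w c \<and> e * c \<le> N \<and> e * c dvd n}"
  let ?g = "\<lambda>c. real (tau m c) * real c powr \<alpha>"
  have finP: "finite ?P" by (rule finite_subset[of _ "{1..N} \<times> {1..N}"]) auto
  have j0: "jordan \<alpha> e \<ge> 0" for e by (rule jordan_nonneg[OF assms(1)])
  have H0: "H \<ge> 0"
  proof -
    have "0 \<le> (\<Sum>d\<in>?A. jordan \<alpha> d / real d)" using j0 by (intro sum_nonneg) auto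
    then show ?thesis using H by linarith
  qed
  have "(\<Sum>n\<in>I'. real (tau (Suc m) (b n)) * real (b n) powr \<alpha>) \<le> (\<Sum>n\<in>I'. \<Sum>(e, c)\<in>?R n. jordan \<alpha> e * ?g c)"
  proof (rule sum_mono)
    fix n assume n: "n \<in> I'"
    then have "n > 0" using \<open>I' \<subseteq> I\<close> I(2) by (auto intro!: Nat.gr0I)
    then show "real (tau (Suc m) (b n)) * real (b n) powr \<alpha> \<le> (\<Sum>(e, c)\<in>?R n. jordan \<alpha> e * ?g c)"
      using b[OF n] by (intro tau_powr_le_sum_jordan assms(1)) auto
  qed
  also have "\<dots> \<le> (\<Sum>n\<in>I. \<Sum>(e, c)\<in>?R n. jordan \<alpha> e * ?g c)"
    using I(1) \<open>I' \<subseteq> I\<close> j0 by (intro sum_mono2) (auto intro!: sum_nonneg)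
  also have "\<dots> = (\<Sum>n\<in>I. \<Sum>(e, c)\<in>?P. if e * c dvd n then jordan \<alpha> e * ?g c else 0)"
  proof (rule sum.cong[OF refl])
    fix n
    have eq: "?R n = {a \<in> ?P. fst a * snd a dvd n}" by auto
    show "(\<Sum>(e, c)\<in>?R n. jordan \<alpha> e * ?g c) = (\<Sum>(e, c)\<in>?P. if e * c dvd n then jordan \<alpha> e * ?g c else 0)"
      unfolding eq sum.inter_filter[OF finP] by (rule sum.cong) auto
  qed
  also have "\<dots> = (\<Sum>(e, c)\<in>?P. \<Sum>n\<in>I. if e * c dvd n then jordan \<alpha> e * ?g c else 0)"
    by (subst sum.swap) (simp add: case_prod_beta)
  also have "\<dots> \<le> (\<Sum>(e, c)\<in>?P. 2 * y * (jordan \<alpha> e / real e * (real (tau m c) * real c powr (\<alpha> - 1))))"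
  proof (rule sum_mono, clarify)
    fix e c assume ec: "e \<in> {1..N}" "smooth w e" "c \<in> {1..N}" "smooth w c" "e * c \<le> N"
    have "(\<Sum>n\<in>I. if e * c dvd n then jordan \<alpha> e * ?g c else 0) = real (card {n \<in> I. e * c dvd n}) * (jordan \<alpha> e * ?g c)"
      using I(1) by (simp flip: sum.inter_filter)
    also have "\<dots> \<le> 2 * y / real (e * c) * (jordan \<alpha> e * ?g c)"
      using ec j0 by (intro mult_right_mono I(4)) (auto simp: Suc_le_eq)
    also have "\<dots> = 2 * y * (jordan \<alpha> e / real e * (real (tau m c) * real c powr (\<alpha> - 1)))"
      using ec by (simp add: powr_diff field_simps)
    finally show "(\<Sum>n\<in>I. if e * c dvd n then jordan \<alpha> e * ?g c else 0)
        \<le> 2 * y * (jordan \<alpha> e / real e * (real (tau m c) * real c powr (\<alpha> - 1)))" .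
  qed
  also have "\<dots> \<le> (\<Sum>(e, c)\<in>?A \<times> ?A. 2 * y * (jordan \<alpha> e / real e * (real (tau m c) * real c powr (\<alpha> - 1))))"
    using j0 I(3) by (intro sum_mono2) (auto intro!: mult_nonneg_nonneg)
  also have "\<dots> = 2 * y * ((\<Sum>e\<in>?A. jordan \<alpha> e / real e) * (\<Sum>c\<in>?A. real (tau m c) * real c powr (\<alpha> - 1)))"
    unfolding sum_product sum.cartesian_product by (simp only: sum_distrib_left case_prod_unfold)
  also have "\<dots> \<le> 2 * y * (H * (H * (1 + ln (real N))) ^ m)"
  proof (intro mult_left_mono mult_mono H H0)
    \<comment> \<open>The weight is completely multiplicative and smoothness is inherited by
      divisors, so each of the \<open>m\<close> factors contributes \<open>H\<close> and one
      logarithm.\<close>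
    have "(\<Sum>c\<in>?A. real (tau m c) * real c powr (\<alpha> - 1)) \<le> (\<Sum>c\<in>?A. real c powr (\<alpha> - 1)) ^ m"
      by (rule tau_weighted_sum_le) (auto simp: powr_mult intro: smooth_dvd)
    also have "\<dots> \<le> (H * (1 + ln (real N))) ^ m"
      by (intro power_mono sum_smooth_powr_le assms sum_nonneg) auto
    finally show "(\<Sum>c\<in>?A. real (tau m c) * real c powr (\<alpha> - 1)) \<le> (H * (1 + ln (real N))) ^ m" .
  qed (use I(3) in \<open>auto intro!: sum_nonneg\<close>)
  finally show ?thesis by (simp add: power_mult_distrib mult.assoc)
qed


text \<open>Take the largest divisor \<open>b \<le> z\<close> none of whose primes exceeds a prime
  of \<open>n div b\<close>. If the cofactor is not 1 and \<open>q\<close> is its least prime, then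
  \<open>b * q\<close> has the same ordering property, so maximality forces
  \<open>b * q > z\<close>.\<close>

lemma greedy_factorisation:
  fixes z :: real
  assumes "n > 0" "z \<ge> 1"
  obtains b where "b dvd n" "real b \<le> z" "n = b"
  | b c q where "n = b * c" "real b \<le> z" "prime q" "z < real b * real q" "smooth (real q) b"
      "\<And>p. prime p \<Longrightarrow> p dvd c \<Longrightarrow> q \<le> p"
proof -
  define S where "S = {b. b dvd n \<and> real b \<le> z \<and>
    (\<forall>p r. prime p \<longrightarrow> prime r \<longrightarrow> p dvd b \<longrightarrow> r dvd n div b \<longrightarrow> p \<le> r)}"
  have "finite S" by (rule finite_subset[of _ "{d. d dvd n}"]) (use assms(1) in \<open>auto simp: S_def\<close>)
  moreover have "1 \<in> S" using assms(2) by (auto simp: S_def)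
  ultimately have "Max S \<in> S" and max: "\<And>b. b \<in> S \<Longrightarrow> b \<le> Max S"
    by (auto intro!: Max_in)
  define b where "b = Max S"
  have bS: "b dvd n" "real b \<le> z"
    "\<And>p r. prime p \<Longrightarrow> prime r \<Longrightarrow> p dvd b \<Longrightarrow> r dvd n div b \<Longrightarrow> p \<le> r"
    using \<open>Max S \<in> S\<close> unfolding b_def S_def by blast+
  have b0: "b > 0" using bS(1) assms(1) by (rule dvd_pos_nat[rotated])
  define c where "c = n div b"
  have nbc: "n = b * c" unfolding c_def using bS(1) by simp
  show ?thesis
  proof (cases "c = 1")
    case True
    then show ?thesis using that(1)[of b] bS nbc by simp
  next
    case False
    define q where "q = (LEAST p. prime p \<and> p dvd c)"
    have ex: "\<exists>p. prime p \<and> p dvd c" using False prime_factor_nat by blast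
    have q: "prime q" "q dvd c" using LeastI_ex[OF ex] unfolding q_def by simp_all
    have qmin: "q \<le> p" if "prime p" "p dvd c" for p
      using that unfolding q_def by (simp add: Least_le)
    obtain c' where c': "c = q * c'" using q(2) by blast
    have q1: "q > 1" using q(1) by (rule prime_gt_1_nat)
    have bq: "p \<le> q" if "prime p" "p dvd b" for p
      using bS(3)[OF that(1) q(1) that(2)] q(2) unfolding c_def by simp
    have "z < real b * real q"
    proof (rule ccontr)
      assume "\<not> z < real b * real q"
      then have le: "real (b * q) \<le> z" by simp
      have div: "n div (b * q) = c'" using nbc c' b0 q1 by simp
      have "p \<le> r" if pr: "prime p" "prime r" "p dvd b * q" "r dvd n div (b * q)" for p r
      proof -
        have "r dvd c" using pr(4) unfolding div c' by simp
        then have qr: "q \<le> r" using qmin pr(2) by simp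
        have "p dvd b \<or> p dvd q" using pr(1,3) by (simp add: prime_dvd_mult_iff)
        then have "p \<le> q"
        proof
          assume "p dvd q"
          then show ?thesis using q1 by (simp add: dvd_imp_le)
        qed (use bq pr(1) in simp)
        with qr show ?thesis by simp
      qed
      moreover have "b * q dvd n" unfolding nbc c' by simp
      ultimately have "b * q \<in> S" using le unfolding S_def by simp
      then have "b * q \<le> b" using max unfolding b_def by blast
      with b0 q1 show False by simp
    qed
    moreover have "smooth (real q) b" unfolding smooth_def using bq by simp
    ultimately show ?thesis using that(2)[of b c q] nbc bS(2) q(1) qmin by blast
  qed
qed

section \<open>Counting multiples, and union bounds\<close>

lemma card_multiples_le:
  fixes x y :: real
  assumes "d > 0" "y \<ge> 0"
  shows "real (card {n. n \<ge> 1 \<and> x - y < real n \<and> real n \<le> x \<and> d dvd n}) \<le> y / real d + 1"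
proof -
  let ?A = "{n. n \<ge> 1 \<and> x - y < real n \<and> real n \<le> x \<and> d dvd n}"
  let ?B = "{\<lfloor>(x - y) / real d\<rfloor> + 1..\<lfloor>x / real d\<rfloor>}"
  have "(\<lambda>n. int (n div d)) ` ?A \<subseteq> ?B"
  proof
    fix k assume "k \<in> (\<lambda>n. int (n div d)) ` ?A"
    then obtain j where j: "k = int j" "x - y < real d * real j" "real d * real j \<le> x"
      using assms(1) by (auto elim!: dvdE)
    have "(x - y) / real d < real j" "real j \<le> x / real d"
      using j(2,3) assms(1) by (simp_all add: pos_divide_less_eq pos_le_divide_eq mult.commute)
    then show "k \<in> ?B" unfolding j(1) by (auto simp: floor_less_iff le_floor_iff less_imp_le zless_imp_add1_zle)
  qed
  then have "card ((\<lambda>n. int (n div d)) ` ?A) \<le> card ?B" by (intro card_mono) auto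
  moreover have "inj_on (\<lambda>n. int (n div d)) ?A"
  proof (rule inj_onI)
    fix a b assume "a \<in> ?A" "b \<in> ?A" and eq: "int (a div d) = int (b div d)"
    then have "d dvd a" "d dvd b" by blast+
    then have "a = d * (a div d)" "b = d * (b div d)" by simp_all
    moreover have "a div d = b div d" using eq by simp
    ultimately show "a = b" by metis
  qed
  ultimately have "card ?A \<le> card ?B" by (simp add: card_image)
  then have "real (card ?A) \<le> real (nat (\<lfloor>x / real d\<rfloor> - \<lfloor>(x - y) / real d\<rfloor>))" by simp
  also have "\<dots> \<le> y / real d + 1"
  proof (cases "\<lfloor>x / real d\<rfloor> - \<lfloor>(x - y) / real d\<rfloor> \<ge> 0")
    case True
    then have "real (nat (\<lfloor>x / real d\<rfloor> - \<lfloor>(x - y) / real d\<rfloor>)) = real_of_int \<lfloor>x / real d\<rfloor> - real_of_int \<lfloor>(x - y) / real d\<rfloor>"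
      by simp
    also have "\<dots> \<le> x / real d - (x - y) / real d + 1" by linarith
    finally show ?thesis by (simp add: diff_divide_distrib)
  next
    case False
    then show ?thesis using assms by simp
  qed
  finally show ?thesis .
qed

lemma sum_Un_le:
  fixes f :: "'a \<Rightarrow> real"
  assumes "finite A" "finite B" "\<And>x. f x \<ge> 0"
  shows "sum f (A \<union> B) \<le> sum f A + sum f B"
proof -
  have "sum f (A \<inter> B) \<ge> 0" by (intro sum_nonneg assms)
  then show ?thesis using sum.union_inter[OF assms(1,2), of f] by linarith
qed

lemma sum_UN_le:
  fixes f :: "'a \<Rightarrow> real"
  assumes "finite A" "\<And>a. finite (B a)" "\<And>x. f x \<ge> 0"
  shows "sum f (\<Union>a\<in>A. B a) \<le> (\<Sum>a\<in>A. sum f (B a))"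
  using assms(1)
proof (induction A rule: finite_induct)
  case empty
  then show ?case by simp
next
  case (insert a A)
  have "sum f (\<Union>a\<in>insert a A. B a) \<le> sum f (B a) + sum f (\<Union>a\<in>A. B a)"
    using sum_Un_le[of "B a" "\<Union>a\<in>A. B a" f] assms insert.hyps by simp
  then show ?case using insert by simp
qed

text \<open>As \<open>c \<le> n \<le> exp X\<close>, the quotient \<open>X / ln q\<close> bounds the
  number of prime factors of \<open>c\<close>, each of which costs a factor
  \<open>M\<close>.\<close>

lemma tau_cofactor_le:
  assumes "M \<ge> 1" "n = b * c" "n > 0" "real n \<le> exp X" "X \<ge> 0" "q > 1"
    "\<And>p. prime p \<Longrightarrow> p dvd c \<Longrightarrow> q \<le> real p" and t: "X / ln q \<le> t"
  shows "real (tau M n) \<le> exp (ln (real M) * t) * real (tau M b)"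
proof -
  have pos: "b > 0" "c > 0" using assms(2,3) by simp_all
  have lnM: "ln (real M) \<ge> 0" using assms(1) by simp
  have lnq: "ln q > 0" using assms(6) by simp
  have "real (tau M n) \<le> real (tau M b) * real c powr (ln (real M) / ln q)"
    unfolding assms(2) by (rule tau_mult_rough_le[OF assms(1,6) pos assms(7)])
  also have "\<dots> \<le> real (tau M b) * exp (ln (real M) * t)"
  proof (rule mult_left_mono)
    have "1 * real c \<le> real b * real c" using pos by (intro mult_right_mono) auto
    then have "real c \<le> exp X" using assms(2,4) by simp
    then have "real c powr (ln (real M) / ln q) \<le> exp X powr (ln (real M) / ln q)"
      using lnM lnq by (intro powr_mono2) auto
    also have "\<dots> = exp (ln (real M) * (X / ln q))" by (simp add: powr_def)
    also have "\<dots> \<le> exp (ln (real M) * t)" using mult_left_mono[OF t lnM] by (simp only: exp_le_cancel_iff)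
    finally show "real c powr (ln (real M) / ln q) \<le> exp (ln (real M) * t)" .
  qed simp
  finally show ?thesis by (simp add: mult.commute)
qed

text \<open>A bound of Shiu's type. Every \<open>n\<close> is factored greedily at the cube root
  \<open>exp Z\<close> of \<open>x\<close>, and the classes \<open>J0\<close>, \<open>J r\<close>
  and \<open>T\<close> sort the \<open>n\<close> by the size of the resulting prime
  \<open>q\<close>.\<close>

lemma sum_tau_short_interval_le:
  "\<exists>C\<ge>0. \<forall>x y :: real. exp 2 \<le> x \<longrightarrow> x powr (1/3) \<le> y \<longrightarrow>
     (\<Sum>n | n \<ge> 1 \<and> x - y < real n \<and> real n \<le> x. real (tau (Suc m) n)) \<le> C * y * ln x ^ m"
proof -
  define M where "M = Suc m"
  define \<mu> where "\<mu> = ln (real M)"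
  \<comment> \<open>On \<open>J r\<close> the cofactor costs
    \<open>exp (3 * \<mu> * (r + 1))\<close>, while Rankin's trick gains
    \<open>exp (\<kappa> * r / 2) = exp (3 * \<mu> * r + r)\<close>. The surplus
    \<open>exp (- r)\<close> is summable over \<open>r\<close>.\<close>
  define \<kappa> where "\<kappa> = 6 * \<mu> + 2"
  define H where "H = exp (4 * exp \<kappa> * (2 * \<kappa> + 1))"
  \<comment> \<open>Once \<open>Z / r\<close> drops below \<open>2 * \<kappa>\<close>, the Rankin
    exponent \<open>\<kappa> * r / Z\<close> passes \<open>1/2\<close>; primes \<open>q\<close> up
    to this constant are treated separately in \<open>T\<close>.\<close>
  define w where "w = exp (2 * \<kappa>)"
  have mu0: "\<mu> \<ge> 0" unfolding \<mu>_def M_def by simp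
  have kappa2: "\<kappa> \<ge> 2" unfolding \<kappa>_def using mu0 by simp
  \<comment> \<open>As \<open>x = exp (3 * Z)\<close> and \<open>N \<le> exp Z\<close>, the
    exponents \<open>1/24\<close> and \<open>1/8\<close> cost \<open>exp (Z / 8)\<close> each,
    together less than the saving \<open>exp (Z / 2)\<close> that \<open>b \<ge> exp (Z / 2)\<close>
    brings on \<open>T\<close>.\<close>
  obtain D where D: "D \<ge> 0" "\<And>n. n \<ge> 1 \<Longrightarrow> real (tau M n) \<le> D * real n powr (1/24)"
    using tau_le_powr[of "1/24" M] unfolding M_def by auto
  obtain E where E: "E \<ge> 0" "\<And>N. real (card {n. n \<in> {1..N} \<and> smooth w n}) \<le> E * real N powr (1/8)"
    using card_smooth_le[of "1/8" w] by auto
  define C where "C = (exp (6 * \<mu>) + 2 * exp (3 * \<mu>)) * (2 * H ^ M) + 2 * D * E"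
  have H0: "H > 0" unfolding H_def by simp
  have "(\<Sum>n | n \<ge> 1 \<and> x - y < real n \<and> real n \<le> x. real (tau M n)) \<le> C * y * ln x ^ m"
    if x: "exp 2 \<le> x" and y: "x powr (1/3) \<le> y" for x y :: real
  proof -
    have x0: "x > 0" using x exp_gt_zero[of 2] by linarith
    have lnx: "ln x \<ge> 2" using x x0 by (simp add: ln_ge_iff)
    define Z where "Z = ln x / 3"
    have Z0: "Z > 0" unfolding Z_def using lnx by simp
    have xZ: "x = exp (3 * Z)" unfolding Z_def using x0 by simp
    have zZ: "x powr (1/3) = exp Z" unfolding Z_def using x0 by (simp add: powr_def)
    have eZ: "exp Z \<ge> 1" using Z0 by simp
    have y1: "y \<ge> exp Z" "y \<ge> 0" using y zZ eZ by linarith+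
    define N where "N = nat \<lfloor>exp Z\<rfloor>"
    have N: "real N \<le> exp Z" "N \<ge> 1" unfolding N_def using eZ by (auto simp: le_nat_floor)
    have leN: "b \<le> N" if "real b \<le> exp Z" for b unfolding N_def using that by (rule le_nat_floor)
    \<comment> \<open>\<open>ln N\<close> is at most a third of \<open>ln x\<close>, so
      \<open>ln x \<ge> 2\<close> absorbs the 1.\<close>
    have lnN: "1 + ln (real N) \<le> ln x" "ln (real N) \<ge> 0"
    proof -
      have "ln (real N) \<le> ln (exp Z)" using N by (intro ln_mono) auto
      then show "1 + ln (real N) \<le> ln x" unfolding Z_def using lnx by simp
      show "ln (real N) \<ge> 0" using N by simp
    qed
    define I where "I = {n. n \<ge> 1 \<and> x - y < real n \<and> real n \<le> x}"
    have finI: "finite I"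
      by (rule finite_subset[of _ "{..nat \<lfloor>x\<rfloor>}"]) (auto simp: I_def le_nat_floor)
    have I0: "0 \<notin> I" unfolding I_def by simp
    have cardI: "real (card {n \<in> I. d dvd n}) \<le> 2 * y / real d" if d: "d \<in> {1..N}" for d
    proof -
      have "{n \<in> I. d dvd n} = {n. n \<ge> 1 \<and> x - y < real n \<and> real n \<le> x \<and> d dvd n}"
        unfolding I_def by auto
      then have "real (card {n \<in> I. d dvd n}) \<le> y / real d + 1"
        using card_multiples_le[of d y x] d y1 by simp
      \<comment> \<open>The lower bound on \<open>y\<close> enters here: the additive 1 in the count
        is at most \<open>y / d\<close>.\<close>
      moreover have "real d \<le> y" using d N y1 by simp
      then have "1 \<le> y / real d" using d by (simp add: field_simps)
      ultimately show ?thesis by simp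
    qed
    define B where "B = 2 * y * H ^ M * ln x ^ m"
    have B0: "B \<ge> 0" unfolding B_def using y1 H0 lnx by simp
    \<comment> \<open>Shared by \<open>J0\<close> and every \<open>J r\<close>: \<open>K\<close> is
      the cost of the cofactor after the Rankin gain has been deducted.\<close>
    have weighted: "(\<Sum>n\<in>J. real (tau M n)) \<le> K * B"
      if ar: "0 \<le> \<alpha>" "\<alpha> \<le> 1/2" "v \<ge> 1" "\<alpha> * ln v \<le> \<kappa>" and "K \<ge> 0" "J \<subseteq> I"
        and J: "\<And>n. n \<in> J \<Longrightarrow> \<exists>b. b dvd n \<and> b \<le> N \<and> smooth v b \<and> real (tau M n) \<le> K * (real (tau M b) * real b powr \<alpha>)"
      for \<alpha> v K J
    proof -
      obtain b where b: "\<And>n. n \<in> J \<Longrightarrow> b n dvd n \<and> b n \<le> N \<and> smooth v (b n) \<and>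
          real (tau M n) \<le> K * (real (tau M (b n)) * real (b n) powr \<alpha>)"
        using J by metis
      have Hv: "(\<Sum>n | n \<in> {1..N} \<and> smooth v n. jordan \<alpha> n / real n) \<le> H"
        unfolding H_def by (rule sum_smooth_jordan_le[OF ar])
      have "(\<Sum>n\<in>J. real (tau M n)) \<le> (\<Sum>n\<in>J. K * (real (tau M (b n)) * real (b n) powr \<alpha>))"
        using b by (intro sum_mono) blast
      also have "\<dots> = K * (\<Sum>n\<in>J. real (tau M (b n)) * real (b n) powr \<alpha>)"
        by (rule sum_distrib_left[symmetric])
      also have "\<dots> \<le> K * (2 * y * H ^ Suc m * (1 + ln (real N)) ^ m)"
        unfolding M_def
      proof (intro mult_left_mono)
        show "(\<Sum>n\<in>J. real (tau (Suc m) (b n)) * real (b n) powr \<alpha>) \<le> 2 * y * H ^ Suc m * (1 + ln (real N)) ^ m"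
          by (rule sum_tau_smooth_divisor_le[OF ar(1) N(2) Hv finI I0 y1(2) cardI])
             (use b \<open>J \<subseteq> I\<close> in auto)
      qed fact
      also have "\<dots> \<le> K * B"
        unfolding B_def M_def using lnN y1 H0 \<open>K \<ge> 0\<close> by (intro mult_left_mono power_mono) auto
      finally show ?thesis .
    qed
    \<comment> \<open>For \<open>n = b\<close> or \<open>ln q > Z / 2\<close>: the cofactor then has
      at most 6 prime factors.\<close>
    define J0 where "J0 = {n \<in> I. \<exists>b. b dvd n \<and> b \<le> N \<and> real (tau M n) \<le> exp (6 * \<mu>) * real (tau M b)}"
    \<comment> \<open>For \<open>r = \<lfloor>Z / ln q\<rfloor>\<close>, so that
      \<open>q \<le> exp (Z / r)\<close> and the cofactor has at most \<open>3 * (r + 1)\<close>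
      prime factors.\<close>
    define J where "J r = {n \<in> I. \<exists>b. b dvd n \<and> b \<le> N \<and> smooth (exp (Z / real r)) b \<and> exp (Z / 2) \<le> real b
      \<and> real (tau M n) \<le> exp (\<mu> * (3 * (real r + 1))) * real (tau M b)}" for r :: nat
    define T where "T = {n \<in> I. \<exists>b. b dvd n \<and> b \<le> N \<and> smooth w b \<and> exp (Z / 2) \<le> real b}"
    \<comment> \<open>The largest \<open>r\<close> with
      \<open>\<kappa> * r / Z \<le> 1/2\<close>.\<close>
    define R where "R = nat \<lfloor>Z / (2 * \<kappa>)\<rfloor>"
    have cover: "I \<subseteq> J0 \<union> T \<union> (\<Union>r\<in>{1..R}. J r)"
    proof
      fix n assume nI: "n \<in> I"
      then have n0: "n > 0" and nx: "real n \<le> exp (3 * Z)" unfolding I_def xZ by auto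
      show "n \<in> J0 \<union> T \<union> (\<Union>r\<in>{1..R}. J r)"
      proof (rule greedy_factorisation[OF n0 eZ])
        fix b assume b: "b dvd n" "real b \<le> exp Z" "n = b"
        have "1 * real (tau M n) \<le> exp (6 * \<mu>) * real (tau M n)"
          using mu0 by (intro mult_right_mono) auto
        then show ?thesis unfolding J0_def using nI b(3) leN[OF b(2)] by auto
      next
        fix b c q
        assume nbc: "n = b * c" and b: "real b \<le> exp Z" and q: "prime q" and bq: "exp Z < real b * real q"
          and sm: "smooth (real q) b" and qc: "\<And>p. prime p \<Longrightarrow> p dvd c \<Longrightarrow> q \<le> p"
        have bn: "b dvd n" unfolding nbc by simp
        have q1: "real q > 1" using prime_gt_1_nat[OF q] by simp
        have lnq: "ln (real q) > 0" using q1 by simp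
        have cof: "real (tau M n) \<le> exp (\<mu> * t) * real (tau M b)" if "3 * Z / ln (real q) \<le> t" for t
          unfolding \<mu>_def using Z0 qc that
          by (intro tau_cofactor_le[OF _ nbc n0 nx _ q1]) (auto simp: M_def)
        show ?thesis
        proof (cases "ln (real q) > Z / 2")
          case True
          have "3 * Z / ln (real q) \<le> 6" using True lnq by (simp add: field_simps)
          then have "real (tau M n) \<le> exp (6 * \<mu>) * real (tau M b)" using cof[of 6] by (simp add: mult.commute)
          then show ?thesis unfolding J0_def using nI bn leN[OF b] by blast
        next
          case False
          define u where "u = Z / ln (real q)"
          have u2: "u \<ge> 2" unfolding u_def using False lnq by (simp add: field_simps)
          have lnqu: "ln (real q) = Z / u" unfolding u_def using lnq Z0 by simp
          define r where "r = nat \<lfloor>u\<rfloor>"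
          have r: "real r \<le> u" "u < real r + 1" "r \<ge> 1" unfolding r_def using u2 by (auto simp: le_nat_floor)
          have "real q = exp (Z / u)" using lnqu q1 by (metis exp_ln less_trans zero_less_one)
          also have "\<dots> \<le> exp (Z / real r)" using r Z0 by (auto intro!: divide_left_mono)
          finally have qr: "real q \<le> exp (Z / real r)" .
          \<comment> \<open>From \<open>b * q > exp Z\<close> and \<open>q \<le> exp (Z / 2)\<close>
            follows \<open>b \<ge> exp (Z / 2)\<close>, the size on which Rankin's trick
            acts.\<close>
          have "exp (Z / 2) * exp (Z / 2) = exp Z" by (simp flip: exp_add)
          moreover have "real q \<le> exp (Z / 2)"
            using False q1 by (metis exp_ln exp_le_cancel_iff less_trans not_less zero_less_one)
          then have "real b * real q \<le> real b * exp (Z / 2)" by (intro mult_left_mono) auto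
          ultimately have "exp (Z / 2) * exp (Z / 2) < real b * exp (Z / 2)" using bq by linarith
          then have bge: "exp (Z / 2) \<le> real b" by simp
          show ?thesis
          proof (cases "r \<le> R")
            case True
            have "3 * Z / ln (real q) = 3 * u" unfolding u_def by simp
            also have "\<dots> \<le> 3 * (real r + 1)" using r by simp
            finally have "n \<in> J r"
              unfolding J_def using cof nI bn leN[OF b] smooth_mono[OF sm qr] bge by blast
            then show ?thesis using True r(3) by auto
          next
            case False
            then have "R + 1 \<le> r" by simp
            then have "real R + 1 \<le> real r" by linarith
            moreover have "Z / (2 * \<kappa>) < real R + 1" unfolding R_def by linarith
            ultimately have "Z / (2 * \<kappa>) \<le> real r" by linarith
            then have "Z / real r \<le> 2 * \<kappa>" using kappa2 r(3) by (simp add: field_simps)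
            then have "real q \<le> w" using qr unfolding w_def by (smt (verit) exp_le_cancel_iff)
            then have "n \<in> T"
              unfolding T_def using nI bn leN[OF b] smooth_mono[OF sm] bge by blast
            then show ?thesis by simp
          qed
        qed
      qed
    qed
    have sum_J0: "(\<Sum>n\<in>J0. real (tau M n)) \<le> exp (6 * \<mu>) * B"
    \<comment> \<open>The Rankin weight is trivial here, and \<open>b \<le> N\<close> already makes
      \<open>b\<close> smooth for the threshold \<open>exp Z\<close>.\<close>
    proof (rule weighted[of 0 "exp Z"])
      fix n assume "n \<in> J0"
      then obtain b where b: "n \<in> I" "b dvd n" "b \<le> N" "real (tau M n) \<le> exp (6 * \<mu>) * real (tau M b)"
        unfolding J0_def by blast
      have b0: "b > 0" using b(1,2) I0 by (metis dvd_0_left gr0I)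
      have "smooth (exp Z) b"
        unfolding smooth_def
      proof (intro allI impI)
        fix p :: nat assume "prime p" "p dvd b"
        then have "p \<le> N" using dvd_imp_le[OF _ b0] b(3) le_trans by blast
        then show "real p \<le> exp Z" using N(1) by linarith
      qed
      then show "\<exists>b. b dvd n \<and> b \<le> N \<and> smooth (exp Z) b \<and> real (tau M n) \<le> exp (6 * \<mu>) * (real (tau M b) * real b powr 0)"
        using b b0 by (intro exI[of _ b]) simp
    qed (use kappa2 eZ in \<open>auto simp: J0_def\<close>)
    have sum_J: "(\<Sum>n\<in>J r. real (tau M n)) \<le> exp (3 * \<mu>) * exp (-1) ^ r * B" if r: "r \<in> {1..R}" for r
    proof -
      \<comment> \<open>The largest exponent that \<open>\<alpha> * ln v \<le> \<kappa>\<close>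
        permits for \<open>ln v = Z / r\<close>.\<close>
      define \<alpha> where "\<alpha> = \<kappa> * real r / Z"
      have a0: "\<alpha> \<ge> 0" unfolding \<alpha>_def using kappa2 Z0 by simp
      have "real r \<le> Z / (2 * \<kappa>)" using r Z0 kappa2 unfolding R_def by (auto simp: le_nat_floor le_nat_iff le_floor_iff)
      then have a2: "\<alpha> \<le> 1/2" unfolding \<alpha>_def using Z0 kappa2 by (simp add: field_simps)
      have r0: "real r > 0" using r by simp
      show ?thesis
      proof (rule weighted[of \<alpha> "exp (Z / real r)"])
        show "\<alpha> * ln (exp (Z / real r)) \<le> \<kappa>" unfolding \<alpha>_def using Z0 r0 by simp
        show "1 \<le> exp (Z / real r)" using Z0 r0 by simp
        show "J r \<subseteq> I" unfolding J_def by blast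
        fix n assume "n \<in> J r"
        then obtain b where b: "n \<in> I" "b dvd n" "b \<le> N" "smooth (exp (Z / real r)) b" "exp (Z / 2) \<le> real b"
            "real (tau M n) \<le> exp (\<mu> * (3 * (real r + 1))) * real (tau M b)"
          unfolding J_def by blast
        have "exp (Z / 2) powr \<alpha> \<le> real b powr \<alpha>" using b(5) a0 by (intro powr_mono2) auto
        moreover have "exp (Z / 2) powr \<alpha> = exp (\<kappa> * real r / 2)"
          unfolding \<alpha>_def using Z0 by (simp add: powr_def)
        ultimately have rankin: "exp (\<kappa> * real r / 2) \<le> real b powr \<alpha>" by simp
        have "exp (\<mu> * (3 * (real r + 1))) = exp (3 * \<mu>) * exp (-1) ^ r * exp (\<kappa> * real r / 2)"
          unfolding \<kappa>_def by (simp add: exp_of_nat_mult[symmetric] exp_add[symmetric] algebra_simps)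
        also have "\<dots> \<le> exp (3 * \<mu>) * exp (-1) ^ r * real b powr \<alpha>"
          using rankin by (intro mult_left_mono) auto
        finally have "exp (\<mu> * (3 * (real r + 1))) * real (tau M b) \<le> exp (3 * \<mu>) * exp (-1) ^ r * real b powr \<alpha> * real (tau M b)"
          by (intro mult_right_mono) auto
        then have "real (tau M n) \<le> exp (3 * \<mu>) * exp (-1) ^ r * (real (tau M b) * real b powr \<alpha>)"
          using b(6) by (simp add: ac_simps)
        with b show "\<exists>b. b dvd n \<and> b \<le> N \<and> smooth (exp (Z / real r)) b \<and>
            real (tau M n) \<le> exp (3 * \<mu>) * exp (-1) ^ r * (real (tau M b) * real b powr \<alpha>)"
          by blast
      qed (use a0 a2 in auto)
    qed
    \<comment> \<open>\<open>T\<close> is covered by the multiples of the few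
      \<open>w\<close>-smooth \<open>b \<ge> exp (Z / 2)\<close>, and each \<open>tau M n\<close> is
      bounded by a small power of \<open>x\<close>. The net factor \<open>exp (- Z / 4)\<close> is
      at most 1.\<close>
    have sum_T: "(\<Sum>n\<in>T. real (tau M n)) \<le> 2 * D * E * y"
    proof -
      let ?S = "{b. b \<in> {1..N} \<and> smooth w b \<and> exp (Z / 2) \<le> real b}"
      have "T \<subseteq> (\<Union>b\<in>?S. {n \<in> I. b dvd n})"
      proof
        fix n assume "n \<in> T"
        then obtain b where b: "n \<in> I" "b dvd n" "b \<le> N" "smooth w b" "exp (Z / 2) \<le> real b"
          unfolding T_def by blast
        have "b \<noteq> 0" using b(1,2) I0 by (metis dvd_0_left)
        then have "b \<in> ?S" using b by simp
        then show "n \<in> (\<Union>b\<in>?S. {n \<in> I. b dvd n})" using b by blast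
      qed
      then have "card T \<le> card (\<Union>b\<in>?S. {n \<in> I. b dvd n})"
        using finI by (intro card_mono) auto
      also have "\<dots> \<le> (\<Sum>b\<in>?S. card {n \<in> I. b dvd n})" by (intro card_UN_le) auto
      finally have "real (card T) \<le> real (\<Sum>b\<in>?S. card {n \<in> I. b dvd n})"
        by (simp only: of_nat_le_iff)
      also have "\<dots> = (\<Sum>b\<in>?S. real (card {n \<in> I. b dvd n}))" by (rule of_nat_sum)
      also have "\<dots> \<le> (\<Sum>b\<in>?S. 2 * y * exp (- Z / 2))"
      proof (rule sum_mono)
        fix b assume b: "b \<in> ?S"
        then have b0: "real b > 0" by simp
        have "real (card {n \<in> I. b dvd n}) \<le> 2 * y / real b" using b by (intro cardI) simp
        also have "\<dots> \<le> 2 * y / exp (Z / 2)" using b b0 y1 by (intro divide_left_mono) auto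
        also have "\<dots> = 2 * y * exp (- Z / 2)"
          unfolding minus_divide_left[symmetric] exp_minus by (simp only: divide_inverse)
        finally show "real (card {n \<in> I. b dvd n}) \<le> 2 * y * exp (- Z / 2)" .
      qed
      also have "\<dots> = real (card ?S) * (2 * y * exp (- Z / 2))" by simp
      also have "\<dots> \<le> (E * exp (Z / 8)) * (2 * y * exp (- Z / 2))"
      proof (rule mult_right_mono)
        have "card ?S \<le> card {n. n \<in> {1..N} \<and> smooth w n}" by (intro card_mono) auto
        then have "real (card ?S) \<le> E * real N powr (1/8)" using E(2)[of N] by linarith
        also have "real N powr (1/8) \<le> exp Z powr (1/8)" using N by (intro powr_mono2) auto
        also have "exp Z powr (1/8) = exp (Z / 8)" by (simp add: powr_def)
        finally show "real (card ?S) \<le> E * exp (Z / 8)" using E(1) by (simp add: mult_left_mono)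
      qed (use y1 in simp)
      finally have cardT: "real (card T) \<le> (E * exp (Z / 8)) * (2 * y * exp (- Z / 2))" .
      have "(\<Sum>n\<in>T. real (tau M n)) \<le> (\<Sum>n\<in>T. D * exp (Z / 8))"
      proof (rule sum_mono)
        fix n assume "n \<in> T"
        then have n: "n \<ge> 1" "real n \<le> x" unfolding T_def I_def by auto
        have "real (tau M n) \<le> D * real n powr (1/24)" by (rule D(2)[OF n(1)])
        also have "\<dots> \<le> D * x powr (1/24)" using n D(1) by (intro mult_left_mono powr_mono2) auto
        also have "x powr (1/24) = exp (Z / 8)" unfolding xZ by (simp add: powr_def)
        finally show "real (tau M n) \<le> D * exp (Z / 8)" .
      qed
      also have "\<dots> = real (card T) * (D * exp (Z / 8))" by simp
      also have "\<dots> \<le> (E * exp (Z / 8)) * (2 * y * exp (- Z / 2)) * (D * exp (Z / 8))"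
        using cardT D(1) by (intro mult_right_mono) auto
      also have "\<dots> = 2 * D * E * y * (exp (Z / 8) * exp (- Z / 2) * exp (Z / 8))" by simp
      also have "exp (Z / 8) * exp (- Z / 2) * exp (Z / 8) = exp (- Z / 4)" by (simp flip: exp_add)
      also have "2 * D * E * y * exp (- Z / 4) \<le> 2 * D * E * y * 1"
        using Z0 D(1) E(1) y1 by (intro mult_left_mono) auto
      finally show ?thesis by simp
    qed
    have fin: "finite J0" "finite T" "\<And>r. finite (J r)"
      using finI unfolding J0_def T_def J_def by simp_all
    have "(\<Sum>n\<in>I. real (tau M n)) \<le> (\<Sum>n\<in>J0 \<union> T \<union> (\<Union>r\<in>{1..R}. J r). real (tau M n))"
      using fin cover by (intro sum_mono2) auto
    also have "\<dots> \<le> (\<Sum>n\<in>J0. real (tau M n)) + (\<Sum>n\<in>T. real (tau M n)) + (\<Sum>n\<in>(\<Union>r\<in>{1..R}. J r). real (tau M n))"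
    proof -
      have "finite (\<Union>r\<in>{1..R}. J r)" "finite (J0 \<union> T)" using fin by auto
      from sum_Un_le[OF this(2,1), of "\<lambda>n. real (tau M n)"] sum_Un_le[OF fin(1,2), of "\<lambda>n. real (tau M n)"]
      show ?thesis by simp
    qed
    also have "(\<Sum>n\<in>(\<Union>r\<in>{1..R}. J r). real (tau M n)) \<le> (\<Sum>r\<in>{1..R}. \<Sum>n\<in>J r. real (tau M n))"
      using fin by (intro sum_UN_le) auto
    also have "\<dots> \<le> (\<Sum>r\<in>{1..R}. exp (3 * \<mu>) * exp (-1) ^ r * B)" by (intro sum_mono sum_J)
    also have "\<dots> = exp (3 * \<mu>) * B * (\<Sum>r\<in>{1..R}. exp (-1) ^ r)"
      by (simp add: sum_distrib_left ac_simps)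
    also have "\<dots> \<le> exp (3 * \<mu>) * B * 2"
    proof (rule mult_left_mono)
      have e2: "exp (-1 :: real) \<le> 1/2"
        using exp_ge_add_one_self[of "1 :: real"] by (simp add: exp_minus field_simps)
      have "(\<Sum>r\<in>{1..R}. exp (-1 :: real) ^ r) \<le> (\<Sum>r\<le>R. exp (-1) ^ r)" by (intro sum_mono2) auto
      also have "\<dots> \<le> 1 / (1 - exp (-1))" by (intro sum_geometric_le) (use e2 in auto)
      also have "\<dots> \<le> 2" using e2 by (simp add: field_simps)
      finally show "(\<Sum>r\<in>{1..R}. exp (-1 :: real) ^ r) \<le> 2" .
    qed (use B0 in simp)
    finally have "(\<Sum>n\<in>I. real (tau M n)) \<le> exp (6 * \<mu>) * B + 2 * D * E * y + exp (3 * \<mu>) * B * 2"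
      using sum_J0 sum_T by linarith
    also have "\<dots> \<le> exp (6 * \<mu>) * B + 2 * D * E * y * ln x ^ m + exp (3 * \<mu>) * B * 2"
    proof -
      have "1 \<le> ln x ^ m" using lnx by (intro one_le_power) simp
      then have "2 * D * E * y * 1 \<le> 2 * D * E * y * ln x ^ m"
        using D(1) E(1) y1 by (intro mult_left_mono) auto
      then show ?thesis by simp
    qed
    also have "\<dots> = C * y * ln x ^ m" unfolding B_def C_def by (simp add: algebra_simps)
    finally show ?thesis unfolding I_def .
  qed
  moreover have "C \<ge> 0" unfolding C_def using D(1) E(1) H0 by simp
  ultimately show ?thesis unfolding M_def by blast
qed


subsection \<open>Sums over integer parts\<close>

lemma card_nat_between:
  fixes a b :: real
  assumes "0 \<le> a" "a \<le> b"
  shows "\<bar>real (card {n :: nat. a < real n \<and> real n \<le> b}) - (b - a)\<bar> \<le> 1"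
proof -
  have "{n :: nat. a < real n \<and> real n \<le> b} = {nat \<lfloor>a\<rfloor><..nat \<lfloor>b\<rfloor>}"
    using assms by (auto simp: le_nat_floor) linarith+
  then have "real (card {n :: nat. a < real n \<and> real n \<le> b}) = real (nat \<lfloor>b\<rfloor> - nat \<lfloor>a\<rfloor>)" by simp
  also have "nat \<lfloor>a\<rfloor> \<le> nat \<lfloor>b\<rfloor>" using assms by (intro nat_mono floor_mono)
  then have "real (nat \<lfloor>b\<rfloor> - nat \<lfloor>a\<rfloor>) = of_int \<lfloor>b\<rfloor> - of_int \<lfloor>a\<rfloor>"
    using assms by (simp add: of_nat_diff)
  finally show ?thesis by linarith
qed

lemma nat_floor_divide_eq_iff:
  fixes x :: real
  assumes "x \<ge> 0" "n \<ge> 1" "d \<ge> 1"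
  shows "nat \<lfloor>x / real n\<rfloor> = d \<longleftrightarrow> x / real (d + 1) < real n \<and> real n \<le> x / real d"
proof -
  have "nat \<lfloor>x / real n\<rfloor> = d \<longleftrightarrow> \<lfloor>x / real n\<rfloor> = int d" using assms by auto
  also have "\<dots> \<longleftrightarrow> real d \<le> x / real n \<and> x / real n < real d + 1" by (simp add: floor_eq_iff)
  also have "\<dots> \<longleftrightarrow> x / real (d + 1) < real n \<and> real n \<le> x / real d"
    using assms by (auto simp: field_simps)
  finally show ?thesis .
qed

lemma less_nat_floor_divide_iff:
  fixes x :: real
  assumes "n \<ge> 1"
  shows "D < nat \<lfloor>x / real n\<rfloor> \<longleftrightarrow> real n \<le> x / real (D + 1)"
proof -
  have "D < nat \<lfloor>x / real n\<rfloor> \<longleftrightarrow> int D + 1 \<le> \<lfloor>x / real n\<rfloor>" by linarith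
  also have "\<dots> \<longleftrightarrow> real D + 1 \<le> x / real n" by (simp add: le_floor_iff)
  also have "\<dots> \<longleftrightarrow> real n \<le> x / real (D + 1)"
    using assms by (simp add: field_simps)
  finally show ?thesis .
qed

text \<open>The map \<open>n \<mapsto> n\<lfloor>x/n\<rfloor>\<close> sends \<open>n \<le> y\<close> into \<open>(x - y, x]\<close>, and \<open>n\<close> is recovered from its image
  and the divisor \<open>\<lfloor>x/n\<rfloor>\<close>.\<close>

lemma sum_tau_floor_le_short_interval:
  fixes x y :: real
  assumes "y \<le> x"
  shows "(\<Sum>n | n \<ge> 1 \<and> real n \<le> y. real (tau k (nat \<lfloor>x / real n\<rfloor>)))
    \<le> (\<Sum>m | m \<ge> 1 \<and> x - y < real m \<and> real m \<le> x. real (tau (Suc k) m))"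
proof -
  let ?N = "{n :: nat. n \<ge> 1 \<and> real n \<le> y}"
  let ?I = "{m :: nat. m \<ge> 1 \<and> x - y < real m \<and> real m \<le> x}"
  let ?S = "SIGMA m:?I. {d. d dvd m}"
  let ?\<phi> = "\<lambda>n. (n * nat \<lfloor>x / real n\<rfloor>, nat \<lfloor>x / real n\<rfloor>)"
  have finI: "finite ?I" by (rule finite_subset[of _ "{..nat \<lfloor>x\<rfloor>}"]) (auto simp: le_nat_floor)
  have fl: "real n * real (nat \<lfloor>x / real n\<rfloor>) \<le> x" "x - y < real n * real (nat \<lfloor>x / real n\<rfloor>)"
    "nat \<lfloor>x / real n\<rfloor> \<ge> 1" if n: "n \<in> ?N" for n
  proof -
    have n0: "real n > 0" and ny: "real n \<le> y" using n by auto
    then have "x / real n \<ge> 1" using assms by (simp add: field_simps)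
    then have q: "real (nat \<lfloor>x / real n\<rfloor>) \<le> x / real n" "x / real n < real (nat \<lfloor>x / real n\<rfloor>) + 1"
      and ge1: "nat \<lfloor>x / real n\<rfloor> \<ge> 1" by linarith+
    show "nat \<lfloor>x / real n\<rfloor> \<ge> 1" by (rule ge1)
    show "real n * real (nat \<lfloor>x / real n\<rfloor>) \<le> x" using mult_left_mono[OF q(1), of "real n"] n0 by simp
    have "x < real n * (real (nat \<lfloor>x / real n\<rfloor>) + 1)"
      using mult_strict_left_mono[OF q(2) n0] n0 by simp
    then show "x - y < real n * real (nat \<lfloor>x / real n\<rfloor>)" using ny by (simp add: distrib_left)
  qed
  have inj: "inj_on ?\<phi> ?N"
  proof (rule inj_onI)
    fix a b assume a: "a \<in> ?N" and b: "b \<in> ?N" and eq: "?\<phi> a = ?\<phi> b"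
    have "a * nat \<lfloor>x / real a\<rfloor> = b * nat \<lfloor>x / real b\<rfloor>" "nat \<lfloor>x / real a\<rfloor> = nat \<lfloor>x / real b\<rfloor>"
      using arg_cong[OF eq, of fst] arg_cong[OF eq, of snd] unfolding fst_conv snd_conv .
    then have "a * nat \<lfloor>x / real b\<rfloor> = b * nat \<lfloor>x / real b\<rfloor>" by metis
    moreover have "nat \<lfloor>x / real b\<rfloor> \<noteq> 0" using fl(3)[OF b] by linarith
    ultimately show "a = b" by (metis mult_cancel2)
  qed
  have sub: "?\<phi> ` ?N \<subseteq> ?S"
  proof
    fix z assume "z \<in> ?\<phi> ` ?N"
    then obtain n where n: "n \<in> ?N" "z = ?\<phi> n" by blast
    have "n * nat \<lfloor>x / real n\<rfloor> \<ge> 1" using n(1) fl(3)[OF n(1)] by simp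
    then have "n * nat \<lfloor>x / real n\<rfloor> \<in> ?I" using fl(1,2)[OF n(1)] by simp
    then show "z \<in> ?S" using n(2) by simp
  qed
  have "(\<Sum>n\<in>?N. real (tau k (nat \<lfloor>x / real n\<rfloor>))) = (\<Sum>z\<in>?\<phi> ` ?N. real (tau k (snd z)))"
    unfolding sum.reindex[OF inj] by simp
  also have "\<dots> \<le> (\<Sum>z\<in>?S. real (tau k (snd z)))"
    using sub finI by (intro sum_mono2) auto
  also have "\<dots> = (\<Sum>m\<in>?I. \<Sum>d | d dvd m. real (tau k d))"
    using finI by (subst sum.Sigma) (auto simp: case_prod_beta)
  also have "\<dots> = (\<Sum>m\<in>?I. real (tau (Suc k) m))"
    by (intro sum.cong) (simp_all add: tau_Suc')
  finally show ?thesis .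
qed

text \<open>The index \<open>Suc (n + D)\<close> runs over the integers above \<open>D\<close>; the
  uniform bound on partial sums gives both convergence and the estimate.\<close>

lemma suminf_tau_div_square_le:
  obtains C where "C \<ge> 0"
    "\<And>D. D \<ge> 1 \<Longrightarrow> summable (\<lambda>n. real (tau (Suc j) (Suc (n + D))) / real (Suc (n + D)) ^ 2)"
    "\<And>D. D \<ge> 1 \<Longrightarrow> (\<Sum>n. real (tau (Suc j) (Suc (n + D))) / real (Suc (n + D)) ^ 2) \<le> C * (1 + ln (real D)) ^ j / real D"
proof -
  let ?t = "\<lambda>n. real (tau (Suc j) n) / real n ^ 2"
  obtain C where C: "C \<ge> 0"
    "\<And>D M. D \<ge> 1 \<Longrightarrow> (\<Sum>n\<in>{D<..M}. ?t n) \<le> C * (1 + ln (real D)) ^ j / real D"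
    using sum_tau_div_square_le[of j] by blast
  have part: "(\<Sum>n<M. ?t (Suc (n + D))) \<le> C * (1 + ln (real D)) ^ j / real D" if "D \<ge> 1" for D M
  proof -
    have "(\<Sum>n<M. ?t (Suc (n + D))) = (\<Sum>n\<in>{D<..D + M}. ?t n)"
      by (rule sum.reindex_bij_witness[of _ "\<lambda>n. n - Suc D" "\<lambda>n. Suc (n + D)"]) auto
    then show ?thesis using C(2)[OF that] by simp
  qed
  have summ: "summable (\<lambda>n. ?t (Suc (n + D)))" if "D \<ge> 1" for D
    by (rule summableI_nonneg_bounded[OF _ part[OF that]]) simp
  show ?thesis
    by (rule that[OF C(1) summ suminf_le_const[OF summ part]])
qed

text \<open>A quotient exceeds \<open>D\<close> exactly when \<open>n \<le> x / (D + 1)\<close>. The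
  other terms are grouped by the value \<open>d\<close> of the quotient.\<close>

lemma sum_floor_eq:
  fixes f :: "nat \<Rightarrow> complex" and x :: real
  assumes "x \<ge> 0" "D \<ge> 1"
  shows "(\<Sum>n = 1..nat \<lfloor>x\<rfloor>. f (nat \<lfloor>x / real n\<rfloor>)) =
    (\<Sum>n | n \<ge> 1 \<and> real n \<le> x / real (D + 1). f (nat \<lfloor>x / real n\<rfloor>))
    + (\<Sum>d = 1..D. of_nat (card {n :: nat. x / real (d + 1) < real n \<and> real n \<le> x / real d}) * f d)"
proof -
  let ?q = "\<lambda>n. nat \<lfloor>x / real n\<rfloor>"
  let ?X = "{1..nat \<lfloor>x\<rfloor>}"
  have X: "n \<in> ?X \<longleftrightarrow> n \<ge> 1 \<and> real n \<le> x" for n using assms(1) by (simp add: le_nat_iff le_floor_iff)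
  have q1: "?q n \<ge> 1" if "n \<in> ?X" for n
  proof -
    have "x / real n \<ge> 1" using that unfolding X by simp
    then show ?thesis by linarith
  qed
  have le: "x / real (d + 1) \<le> x" "x / real (Suc d) \<le> x" for d
    using assms(1) by (simp_all add: divide_le_eq mult_left_mono algebra_simps)
  have "(\<Sum>n\<in>?X. f (?q n)) = (\<Sum>n\<in>{n \<in> ?X. D < ?q n}. f (?q n)) + (\<Sum>n\<in>{n \<in> ?X. \<not> D < ?q n}. f (?q n))"
    by (subst sum.union_disjoint[symmetric]) (auto intro!: sum.cong)
  also have "{n \<in> ?X. D < ?q n} = {n. n \<ge> 1 \<and> real n \<le> x / real (D + 1)}"
  proof (rule Collect_cong, rule iffI)
    fix n assume "n \<in> ?X \<and> D < ?q n"
    then show "n \<ge> 1 \<and> real n \<le> x / real (D + 1)"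
      using X less_nat_floor_divide_iff[of n D x] by blast
  next
    fix n assume n: "n \<ge> 1 \<and> real n \<le> x / real (D + 1)"
    then have "real n \<le> x" using le(1)[of D] by linarith
    with n show "n \<in> ?X \<and> D < ?q n"
      using X less_nat_floor_divide_iff[of n D x] by blast
  qed
  also have "(\<Sum>n\<in>{n \<in> ?X. \<not> D < ?q n}. f (?q n)) = (\<Sum>d = 1..D. \<Sum>n | n \<in> {n \<in> ?X. \<not> D < ?q n} \<and> ?q n = d. f (?q n))"
    using q1 by (intro sum.group[symmetric]) auto
  also have "\<dots> = (\<Sum>d = 1..D. of_nat (card {n :: nat. x / real (d + 1) < real n \<and> real n \<le> x / real d}) * f d)"
  proof (rule sum.cong[OF refl])
    fix d assume d: "d \<in> {1..D}"
    have eq: "{n. n \<in> {n \<in> ?X. \<not> D < ?q n} \<and> ?q n = d} = {n. x / real (d + 1) < real n \<and> real n \<le> x / real d}"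
    proof (intro equalityI subsetI)
      fix n assume "n \<in> {n. n \<in> {n \<in> ?X. \<not> D < ?q n} \<and> ?q n = d}"
      then show "n \<in> {n. x / real (d + 1) < real n \<and> real n \<le> x / real d}"
        using nat_floor_divide_eq_iff[of x n d] assms(1) d by auto
    next
      fix n assume n: "n \<in> {n. x / real (d + 1) < real n \<and> real n \<le> x / real d}"
      have "0 \<le> x / real (d + 1)" using assms(1) by simp
      then have "n \<noteq> 0" using n by (intro notI) auto
      then have n1: "n \<ge> 1" by simp
      then have "?q n = d" using nat_floor_divide_eq_iff[of x n d] assms(1) d n by auto
      moreover have "real n \<le> x" using n le(2)[of "d - 1"] d by auto
      ultimately show "n \<in> {n. n \<in> {n \<in> ?X. \<not> D < ?q n} \<and> ?q n = d}"
        using n1 d X[of n] by auto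
    qed
    have "(\<Sum>n | n \<in> {n \<in> ?X. \<not> D < ?q n} \<and> ?q n = d. f (?q n)) = (\<Sum>n | n \<in> {n \<in> ?X. \<not> D < ?q n} \<and> ?q n = d. f d)"
      by (intro sum.cong) auto
    then show "(\<Sum>n | n \<in> {n \<in> ?X. \<not> D < ?q n} \<and> ?q n = d. f (?q n))
        = of_nat (card {n :: nat. x / real (d + 1) < real n \<and> real n \<le> x / real d}) * f d"
      unfolding eq by simp
  qed
  finally show ?thesis .
qed

text \<open>There are three sources of error: the terms with quotient above \<open>D\<close>, a
  rounding error of at most 1 in each count with \<open>d \<le> D\<close>, and the tail of the
  series beyond \<open>D\<close>. The cut \<open>D\<close> stays free, to be chosen according to
  \<open>k\<close>.\<close>

lemma sum_floor_error_le:
  "\<exists>C\<ge>0. \<forall>(f :: nat \<Rightarrow> complex) A x D.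
     A > 0 \<and> (\<forall>n\<ge>1. norm (f n) \<le> A * real (tau (Suc j) n)) \<and> x \<ge> 1 \<and> D \<ge> 1 \<longrightarrow>
       summable (\<lambda>n. f (Suc n) / (of_nat (Suc n) * of_nat (Suc n + 1))) \<and>
       norm ((\<Sum>n = 1..nat \<lfloor>x\<rfloor>. f (nat \<lfloor>x / real n\<rfloor>))
             - of_real x * (\<Sum>n. f (Suc n) / (of_nat (Suc n) * of_nat (Suc n + 1))))
         \<le> A * ((\<Sum>n | n \<ge> 1 \<and> real n \<le> x / real (D + 1). real (tau (Suc j) (nat \<lfloor>x / real n\<rfloor>)))
             + real D * (1 + ln (real D)) ^ j + C * x * (1 + ln (real D)) ^ j / real D)"
proof -
  obtain C where C: "C \<ge> 0"
    "\<And>D. D \<ge> 1 \<Longrightarrow> summable (\<lambda>n. real (tau (Suc j) (Suc (n + D))) / real (Suc (n + D)) ^ 2)"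
    "\<And>D. D \<ge> 1 \<Longrightarrow> (\<Sum>n. real (tau (Suc j) (Suc (n + D))) / real (Suc (n + D)) ^ 2) \<le> C * (1 + ln (real D)) ^ j / real D"
    by (rule suminf_tau_div_square_le[of j]) (rule that)
  let ?t = "\<lambda>n. real (tau (Suc j) (Suc n)) / real (Suc n) ^ 2"
  have main: "summable (\<lambda>n. f (Suc n) / (of_nat (Suc n) * of_nat (Suc n + 1)))"
    "norm (\<Sum>n. f (Suc (n + D)) / (of_nat (Suc (n + D)) * of_nat (Suc (n + D) + 1))) \<le> A * (C * (1 + ln (real D)) ^ j / real D)"
    if A: "A > 0" and f: "\<And>n. n \<ge> 1 \<Longrightarrow> norm (f n) \<le> A * real (tau (Suc j) n)" and D: "D \<ge> 1"
    for f :: "nat \<Rightarrow> complex" and A :: real and D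
  proof -
    let ?g = "\<lambda>n. f (Suc n) / (of_nat (Suc n) * of_nat (Suc n + 1))"
    have bound: "norm (?g n) \<le> A * ?t n" for n
    proof -
      have "norm (?g n) = norm (f (Suc n)) / (real (Suc n) * real (Suc n + 1))"
        by (simp only: norm_divide norm_mult norm_of_nat)
      also have "\<dots> \<le> (A * real (tau (Suc j) (Suc n))) / (real (Suc n) ^ 2)"
        using f[of "Suc n"] A by (intro frac_le) (auto simp: power2_eq_square)
      finally show ?thesis by simp
    qed
    have s: "summable (\<lambda>n. A * ?t (n + D))" by (intro summable_mult C(2) D)
    have sn: "summable (\<lambda>n. norm (?g (n + D)))"
    proof (rule summable_comparison_test'[OF s, of 0])
      show "norm (norm (?g (n + D))) \<le> A * ?t (n + D)" for n
        using bound[of "n + D"] by (simp only: real_norm_def abs_norm_cancel)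
    qed
    then have "summable (\<lambda>n. ?g (n + D))" by (rule summable_norm_cancel)
    then show "summable ?g" by (subst (asm) summable_iff_shift)
    have "norm (\<Sum>n. ?g (n + D)) \<le> (\<Sum>n. norm (?g (n + D)))" by (rule summable_norm[OF sn])
    also have "\<dots> \<le> (\<Sum>n. A * ?t (n + D))" by (intro suminf_le bound sn s)
    also have "\<dots> = A * (\<Sum>n. ?t (n + D))" by (intro suminf_mult C(2) D)
    also have "\<dots> \<le> A * (C * (1 + ln (real D)) ^ j / real D)"
      using A by (intro mult_left_mono C(3) D) simp
    finally show "norm (\<Sum>n. ?g (n + D)) \<le> A * (C * (1 + ln (real D)) ^ j / real D)" .
  qed
  show ?thesis
  proof (intro exI[of _ C] conjI C(1) allI impI; elim conjE)
    fix f :: "nat \<Rightarrow> complex" and A x :: real and D :: nat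
    assume A: "A > 0" and "\<forall>n\<ge>1. norm (f n) \<le> A * real (tau (Suc j) n)" and x: "x \<ge> 1" and D: "D \<ge> 1"
    then have f: "norm (f n) \<le> A * real (tau (Suc j) n)" if "n \<ge> 1" for n using that by blast
    show "summable (\<lambda>n. f (Suc n) / (of_nat (Suc n) * of_nat (Suc n + 1)))"
      by (rule main(1)[OF A f D])
    let ?g = "\<lambda>n. f (Suc n) / (of_nat (Suc n) * of_nat (Suc n + 1))"
    let ?c = "\<lambda>d. card {n :: nat. x / real (d + 1) < real n \<and> real n \<le> x / real d}"
    let ?S1 = "{n :: nat. n \<ge> 1 \<and> real n \<le> x / real (D + 1)}"
    let ?G = "\<Sum>n. ?g (n + D)"
    define F1 where "F1 = (\<Sum>n\<in>?S1. f (nat \<lfloor>x / real n\<rfloor>))"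
    define F2 where "F2 = (\<Sum>d = 1..D. of_nat (?c d) * f d)"
    \<comment> \<open>The head of the main term. As \<open>x / (d * (d + 1))\<close> is the length
      of the interval counted by \<open>?c d\<close>, the difference \<open>F2 - F3\<close> contains
      only rounding errors.\<close>
    define F3 where "F3 = (\<Sum>d = 1..D. of_real (x / (real d * real (d + 1))) * f d)"
    have "(\<Sum>n<D. of_real x * ?g n) = F3"
      unfolding F3_def
      by (rule sum.reindex_bij_witness[of _ "\<lambda>n. n - 1" "Suc"]) (auto simp: field_simps)
    moreover have "(\<Sum>n. ?g n) = ?G + (\<Sum>n<D. ?g n)"
      by (rule suminf_split_initial_segment[OF main(1)[OF A f D]])
    ultimately have G: "of_real x * (\<Sum>n. ?g n) = F3 + of_real x * ?G"
      by (simp only: distrib_left sum_distrib_left add.commute)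
    have F: "(\<Sum>n = 1..nat \<lfloor>x\<rfloor>. f (nat \<lfloor>x / real n\<rfloor>)) = F1 + F2"
      unfolding F1_def F2_def by (rule sum_floor_eq) (use x D in simp_all)
    have "(\<Sum>n = 1..nat \<lfloor>x\<rfloor>. f (nat \<lfloor>x / real n\<rfloor>)) - of_real x * (\<Sum>n. ?g n)
        = F1 + (F2 - F3) - of_real x * ?G"
      unfolding F G by (simp only: add_diff_eq diff_diff_eq)
    also have "norm \<dots> \<le> norm F1 + norm (F2 - F3) + norm (of_real x * ?G)"
      using norm_triangle_ineq4[of "F1 + (F2 - F3)" "of_real x * ?G"] norm_triangle_ineq[of F1 "F2 - F3"] by linarith
    also have "norm F1 \<le> A * (\<Sum>n\<in>?S1. real (tau (Suc j) (nat \<lfloor>x / real n\<rfloor>)))"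
      unfolding F1_def sum_distrib_left
    proof (rule sum_norm_le)
      fix n assume n: "n \<in> ?S1"
      then have "D < nat \<lfloor>x / real n\<rfloor>" by (subst less_nat_floor_divide_iff) auto
      then show "norm (f (nat \<lfloor>x / real n\<rfloor>)) \<le> A * real (tau (Suc j) (nat \<lfloor>x / real n\<rfloor>))"
        by (intro f) simp
    qed
    also have "norm (F2 - F3) \<le> A * (real D * (1 + ln (real D)) ^ j)"
    proof -
      have "F2 - F3 = (\<Sum>d = 1..D. of_real (real (?c d) - x / (real d * real (d + 1))) * f d)"
        unfolding F2_def F3_def sum_subtractf[symmetric] by (intro sum.cong) (auto simp: left_diff_distrib)
      also have "norm \<dots> \<le> (\<Sum>d = 1..D. A * real (tau (Suc j) d))"
      proof (rule sum_norm_le)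
        fix d assume d: "d \<in> {1..D}"
        have "\<bar>real (?c d) - (x / real d - x / real (d + 1))\<bar> \<le> 1"
          using x d by (intro card_nat_between) (auto intro!: divide_left_mono)
        also have "x / real d - x / real (d + 1) = x / (real d * real (d + 1))"
          using d by (simp add: field_simps)
        finally have "norm (of_real (real (?c d) - x / (real d * real (d + 1))) * f d) \<le> 1 * norm (f d)"
          unfolding norm_mult norm_of_real by (intro mult_right_mono) auto
        also have "\<dots> \<le> A * real (tau (Suc j) d)" using f[of d] d by simp
        finally show "norm (of_real (real (?c d) - x / (real d * real (d + 1))) * f d) \<le> A * real (tau (Suc j) d)" .
      qed
      also have "\<dots> = A * (\<Sum>d = 1..D. real (tau (Suc j) d))" by (rule sum_distrib_left[symmetric])
      also have "\<dots> \<le> A * (real D * (1 + ln (real D)) ^ j)"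
        using A by (intro mult_left_mono sum_tau_le D) simp
      finally show ?thesis .
    qed
    also have "norm (of_real x * ?G) \<le> x * (A * (C * (1 + ln (real D)) ^ j / real D))"
      unfolding norm_mult using main(2)[OF A f D] x by (intro mult_mono) auto
    finally show "norm ((\<Sum>n = 1..nat \<lfloor>x\<rfloor>. f (nat \<lfloor>x / real n\<rfloor>)) - of_real x * (\<Sum>n. ?g n))
         \<le> A * ((\<Sum>n\<in>?S1. real (tau (Suc j) (nat \<lfloor>x / real n\<rfloor>)))
             + real D * (1 + ln (real D)) ^ j + C * x * (1 + ln (real D)) ^ j / real D)"
      by (simp add: algebra_simps)
  qed
qed

text \<open>The error bound is first obtained without this term; its sign allows the exponent to be
  enlarged to the stated one. At \<open>x = exp (exp 1)\<close> the triple logarithm is 0 and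
  \<open>30 / 0 = 0\<close>.\<close>

lemma eps_nonneg:
  assumes "m \<ge> 1" "x \<ge> exp (exp 1)"
  shows "eps m x \<ge> 0"
proof -
  have x0: "x > 0" using assms(2) exp_gt_zero[of "exp 1"] by linarith
  then have l1: "ln x \<ge> exp 1" using assms(2) by (simp add: ln_ge_iff)
  then have "ln x > 0" using exp_gt_zero[of 1] by linarith
  then have l2: "ln (ln x) \<ge> 1" using l1 by (simp add: ln_ge_iff)
  then have "ln (ln (ln x)) \<ge> 0" by simp
  then show ?thesis unfolding eps_def using assms(1) l2 by auto
qed

theorem theorem2p3:
  fixes k :: nat
  assumes "k \<ge> 1"
  shows "\<exists>C x0 :: real. \<forall>(f :: nat \<Rightarrow> complex) (A :: real).
           A > 0 \<and> (\<forall>n\<ge>1. norm (f n) \<le> A * real (tau k n)) \<longrightarrow>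
             summable (\<lambda>n. f (Suc n) / (of_nat (Suc n) * of_nat (Suc n + 1))) \<and>
             (\<forall>x\<ge>x0.
               norm ((\<Sum>n = 1..nat \<lfloor>x\<rfloor>. f (nat \<lfloor>x / real n\<rfloor>))
                     - of_real x * (\<Sum>n. f (Suc n) / (of_nat (Suc n) * of_nat (Suc n + 1))))
               \<le> C * (A * x powr (1/2) * ln x powr (delta k + eps (k + 1) x / 2)))"
proof -
  obtain j where k: "k = Suc j" using assms by (cases k) auto
  obtain E where E: "E \<ge> 0" "\<forall>(f :: nat \<Rightarrow> complex) A x D.
     A > 0 \<and> (\<forall>n\<ge>1. norm (f n) \<le> A * real (tau (Suc j) n)) \<and> x \<ge> 1 \<and> D \<ge> 1 \<longrightarrow>
       summable (\<lambda>n. f (Suc n) / (of_nat (Suc n) * of_nat (Suc n + 1))) \<and>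
       norm ((\<Sum>n = 1..nat \<lfloor>x\<rfloor>. f (nat \<lfloor>x / real n\<rfloor>))
             - of_real x * (\<Sum>n. f (Suc n) / (of_nat (Suc n) * of_nat (Suc n + 1))))
         \<le> A * ((\<Sum>n | n \<ge> 1 \<and> real n \<le> x / real (D + 1). real (tau (Suc j) (nat \<lfloor>x / real n\<rfloor>)))
             + real D * (1 + ln (real D)) ^ j + E * x * (1 + ln (real D)) ^ j / real D)"
    using sum_floor_error_le[of j] by (elim exE conjE) (rule that)
  have ex: "\<exists>K\<ge>0. \<exists>x0. \<forall>x\<ge>x0. \<exists>D\<ge>1. (\<Sum>n | n \<ge> 1 \<and> real n \<le> x / real (D + 1). real (tau (Suc j) (nat \<lfloor>x / real n\<rfloor>)))
             + real D * (1 + ln (real D)) ^ j + E * x * (1 + ln (real D)) ^ j / real D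
           \<le> K * (sqrt x * ln x powr delta k)"
  proof (cases "j = 0")
    case True
    have "\<exists>D\<ge>1. (\<Sum>n | n \<ge> 1 \<and> real n \<le> x / real (D + 1). real (tau (Suc j) (nat \<lfloor>x / real n\<rfloor>)))
             + real D * (1 + ln (real D)) ^ j + E * x * (1 + ln (real D)) ^ j / real D
           \<le> (2 + 2 * E) * (sqrt x * ln x powr delta k)" if x: "x \<ge> exp 1" for x :: real
    proof -
      have x1: "x \<ge> 1" using x one_le_exp_iff[of "1 :: real"] by linarith
      have "ln x > 0" using x exp_gt_one[of "1::real"] by (intro ln_gt_zero) linarith
      then have rhs: "ln x powr delta k = 1" unfolding delta_def k True by simp
      \<comment> \<open>For \<open>k = 1\<close> every value of \<open>tau\<close> is 1, so
        \<open>D\<close> and the number of terms with larger quotient, about \<open>x / D\<close>,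
        balance at \<open>sqrt x\<close> without logarithms.\<close>
      define D where "D = nat \<lfloor>sqrt x\<rfloor>"
      have s1: "sqrt x \<ge> 1" using x1 by simp
      have D: "D \<ge> 1" "real D \<le> sqrt x" "sqrt x < real D + 1" unfolding D_def using s1 by linarith+
      have sq: "x = sqrt x * sqrt x" using x1 by simp
      let ?S = "{n :: nat. n \<ge> 1 \<and> real n \<le> x / real (D + 1)}"
      have y: "x / real (D + 1) \<le> sqrt x"
      proof -
        have "sqrt x * sqrt x \<le> sqrt x * real (D + 1)" using D x1 by (intro mult_left_mono) auto
        then show ?thesis using x1 by (simp add: divide_le_eq)
      qed
      have "(\<Sum>n\<in>?S. real (tau (Suc j) (nat \<lfloor>x / real n\<rfloor>))) = (\<Sum>n\<in>?S. 1)"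
      proof (rule sum.cong[OF refl])
        fix n assume "n \<in> ?S"
        then have "D < nat \<lfloor>x / real n\<rfloor>" by (subst less_nat_floor_divide_iff) auto
        then have "nat \<lfloor>x / real n\<rfloor> > 0" by linarith
        then show "real (tau (Suc j) (nat \<lfloor>x / real n\<rfloor>)) = 1" unfolding True by (simp only: tau_one of_nat_1)
      qed
      also have "\<dots> = real (card ?S)" by simp
      also have "\<dots> \<le> real (card {1..nat \<lfloor>sqrt x\<rfloor>})"
        using y by (intro of_nat_mono card_mono) (auto simp: le_nat_floor)
      also have "\<dots> \<le> sqrt x" using s1 by simp
      finally have s: "(\<Sum>n\<in>?S. real (tau (Suc j) (nat \<lfloor>x / real n\<rfloor>))) \<le> sqrt x" .
      have "sqrt x \<le> 2 * real D" using D by linarith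
      then have "x \<le> 2 * real D * sqrt x"
        using mult_right_mono[of "sqrt x" "2 * real D" "sqrt x"] x1 by simp
      then have "E * x / real D \<le> 2 * E * sqrt x"
        using D(1) mult_left_mono[of x "2 * real D * sqrt x" E] E(1) by (simp add: divide_le_eq ac_simps)
      then show ?thesis
        using s D True rhs by (intro exI[of _ D]) (simp add: algebra_simps)
    qed
    then show ?thesis using E(1) by (intro exI[of _ "2 + 2 * E"] conjI exI[of _ "exp 1"]) auto
  next
    case False
    obtain C where C: "C \<ge> 0" "\<And>x y :: real. exp 2 \<le> x \<Longrightarrow> x powr (1/3) \<le> y \<Longrightarrow>
     (\<Sum>n | n \<ge> 1 \<and> x - y < real n \<and> real n \<le> x. real (tau (Suc (Suc j)) n)) \<le> C * y * ln x ^ Suc j"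
      using sum_tau_short_interval_le[of "Suc j"] by blast
    \<comment> \<open>Guarantees \<open>x / (D + 1) \<ge> x powr (1/3)\<close> for
      \<open>D \<le> sqrt (x * ln x)\<close>, as the short interval bound requires.\<close>
    have "eventually (\<lambda>x :: real. sqrt (x * ln x) + 1 \<le> x powr (2/3)) at_top" by real_asymp
    moreover have "eventually (\<lambda>x :: real. ln x \<le> x) at_top" by real_asymp
    ultimately have "eventually (\<lambda>x :: real. exp 2 \<le> x \<and> sqrt (x * ln x) + 1 \<le> x powr (2/3) \<and> ln x \<le> x) at_top"
      by (auto intro: eventually_conj eventually_ge_at_top)
    then obtain x0 where x0: "\<And>x. x \<ge> x0 \<Longrightarrow> exp 2 \<le> x \<and> sqrt (x * ln x) + 1 \<le> x powr (2/3) \<and> ln x \<le> x"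
      unfolding eventually_at_top_linorder by blast
    let ?K = "C + 2 ^ j + 2 * E * 2 ^ j"
    have "\<exists>D\<ge>1. (\<Sum>n | n \<ge> 1 \<and> real n \<le> x / real (D + 1). real (tau (Suc j) (nat \<lfloor>x / real n\<rfloor>)))
             + real D * (1 + ln (real D)) ^ j + E * x * (1 + ln (real D)) ^ j / real D
           \<le> ?K * (sqrt x * ln x powr delta k)" if "x \<ge> x0" for x
    proof -
      have x: "exp 2 \<le> x" "sqrt (x * ln x) + 1 \<le> x powr (2/3)" "ln x \<le> x" using x0[OF that] by auto
      have xpos: "x > 0" using x(1) exp_gt_zero[of "2 :: real"] by linarith
      have L2: "ln x \<ge> 2" using x(1) xpos by (simp add: ln_ge_iff)
      define s where "s = sqrt x"
      define l where "l = sqrt (ln x)"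
      have ss: "s * s = x" "s > 0" unfolding s_def using xpos by simp_all
      have ll: "l * l = ln x" "l \<ge> 1" unfolding l_def using L2 by simp_all
      have x1: "x \<ge> 1" using x(3) L2 by linarith
      have s1: "s \<ge> 1" unfolding s_def using x1 by simp
      have sl: "sqrt (x * ln x) = s * l" unfolding s_def l_def by (rule real_sqrt_mult)
      have sl1: "s * l \<ge> 1" using mult_mono[of 1 s 1 l] s1 ll(2) by simp
      have rhs: "ln x powr delta k = ln x ^ j * l"
      proof -
        have "delta k = real j + 1/2" unfolding delta_def k using False by simp
        then have "ln x powr delta k = ln x powr real j * ln x powr (1/2)" by (simp add: powr_add)
        also have "\<dots> = ln x ^ j * l" unfolding l_def using L2 by (simp add: powr_realpow powr_half_sqrt)
        finally show ?thesis .
      qed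
      \<comment> \<open>Balances the short interval term, of order
        \<open>x / D * ln x ^ (j + 1)\<close>, against the rounding term, of order
        \<open>D * ln x ^ j\<close>. Both become \<open>s * l * ln x ^ j\<close>, with exponent
        \<open>j + 1/2 = k - 1/2\<close> of \<open>ln x\<close>.\<close>
      define D where "D = nat \<lfloor>s * l\<rfloor>"
      have D: "D \<ge> 1" "real D \<le> s * l" "s * l < real D + 1" unfolding D_def using sl1 by linarith+
      \<comment> \<open>The factor 2 is the source of \<open>2 ^ j\<close> in the constant.\<close>
      have lnD: "1 + ln (real D) \<le> 2 * ln x" "0 \<le> 1 + ln (real D)"
      proof -
        have "s * l \<le> x"
          unfolding sl[symmetric] using x(3) xpos L2 by (intro real_le_lsqrt) (auto simp: power2_eq_square)
        then have "ln (real D) \<le> ln x" using D by (intro ln_mono) auto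
        then show "1 + ln (real D) \<le> 2 * ln x" using L2 by linarith
        show "0 \<le> 1 + ln (real D)" using D(1) by simp
      qed
      then have lnDj: "(1 + ln (real D)) ^ j \<le> 2 ^ j * ln x ^ j"
        unfolding power_mult_distrib[symmetric] by (intro power_mono)
      define y where "y = x / real (D + 1)"
      have yx: "y \<le> x" unfolding y_def using xpos by (simp add: divide_le_eq algebra_simps)
      have yl: "y * l \<le> s"
      proof -
        have "y * (s * l) \<le> y * real (D + 1)" unfolding y_def using D xpos by (intro mult_left_mono) auto
        also have "\<dots> = s * s" unfolding y_def ss(1) by simp
        finally have "s * (y * l) \<le> s * s" by (simp add: ac_simps)
        then show ?thesis using ss(2) by simp
      qed
      have "real (D + 1) \<le> x powr (2/3)" using D x(2) sl by simp
      then have "x powr (1/3) * real (D + 1) \<le> x powr (1/3) * x powr (2/3)" by (intro mult_left_mono) auto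
      also have "\<dots> = x" using xpos by (simp flip: powr_add)
      finally have y3: "x powr (1/3) \<le> y" unfolding y_def by (simp add: pos_le_divide_eq)
      have "(\<Sum>n | n \<ge> 1 \<and> real n \<le> y. real (tau (Suc j) (nat \<lfloor>x / real n\<rfloor>)))
          \<le> (\<Sum>m | m \<ge> 1 \<and> x - y < real m \<and> real m \<le> x. real (tau (Suc (Suc j)) m))"
        by (rule sum_tau_floor_le_short_interval[OF yx])
      also have "\<dots> \<le> C * y * ln x ^ Suc j" by (rule C(2)[OF x(1) y3])
      also have "\<dots> = (C * l * ln x ^ j) * (y * l)" unfolding power_Suc ll(1)[symmetric] by simp
      also have "\<dots> \<le> (C * l * ln x ^ j) * s" using yl C(1) ll(2) L2 by (intro mult_left_mono) auto
      finally have t1: "(\<Sum>n | n \<ge> 1 \<and> real n \<le> x / real (D + 1). real (tau (Suc j) (nat \<lfloor>x / real n\<rfloor>)))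
          \<le> C * (s * (ln x ^ j * l))" unfolding y_def by (simp add: ac_simps)
      have t2: "real D * (1 + ln (real D)) ^ j \<le> 2 ^ j * (s * (ln x ^ j * l))"
      proof -
        have "real D * (1 + ln (real D)) ^ j \<le> (s * l) * (2 ^ j * ln x ^ j)"
          using D lnDj lnD by (intro mult_mono) auto
        then show ?thesis by (simp add: ac_simps)
      qed
      have t3: "E * x * (1 + ln (real D)) ^ j / real D \<le> 2 * E * 2 ^ j * (s * (ln x ^ j * l))"
      proof -
        have "s * 1 \<le> s * l" using ll(2) ss(2) by (intro mult_left_mono) auto
        then have "s \<le> 2 * real D" using D by linarith
        then have "x \<le> s * (2 * real D)" unfolding ss(1)[symmetric] using ss(2) by (intro mult_left_mono) auto
        then have "x / real D \<le> 2 * s" using D(1) by (simp add: divide_le_eq ac_simps)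
        \<comment> \<open>The tail term has room to spare; the factor \<open>l \<ge> 1\<close> is
          inserted to match the other two terms.\<close>
        also have "\<dots> \<le> 2 * s * l" using ll(2) ss(2) by simp
        finally have xD: "x / real D \<le> 2 * s * l" .
        have "0 \<le> 2 ^ j * ln x ^ j" using L2 by (intro mult_nonneg_nonneg zero_le_power) linarith+
        then have "E * ((1 + ln (real D)) ^ j * (x / real D)) \<le> E * ((2 ^ j * ln x ^ j) * (2 * s * l))"
          using E(1) lnDj lnD xD xpos D(1) L2 by (intro mult_left_mono mult_mono) auto
        then show ?thesis by (simp add: ac_simps)
      qed
      show ?thesis
        using t1 t2 t3 D(1) unfolding rhs s_def[symmetric]
        by (intro exI[of _ D]) (simp add: distrib_right)
    qed
    then show ?thesis using C(1) E(1) by (intro exI[of _ ?K] conjI exI[of _ x0]) auto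
  qed
  then obtain K x0 where K: "K \<ge> 0" "\<And>x. x \<ge> x0 \<Longrightarrow> \<exists>D\<ge>1. (\<Sum>n | n \<ge> 1 \<and> real n \<le> x / real (D + 1). real (tau (Suc j) (nat \<lfloor>x / real n\<rfloor>)))
             + real D * (1 + ln (real D)) ^ j + E * x * (1 + ln (real D)) ^ j / real D
           \<le> K * (sqrt x * ln x powr delta k)" by blast
  show ?thesis
  proof (rule exI[of _ K], rule exI[of _ "max x0 (exp (exp 1))"], intro allI impI conjI)
    fix f :: "nat \<Rightarrow> complex" and A :: real
    assume "A > 0 \<and> (\<forall>n\<ge>1. norm (f n) \<le> A * real (tau k n))"
    then have A: "A > 0" and f: "\<forall>n\<ge>1. norm (f n) \<le> A * real (tau (Suc j) n)" unfolding k by blast+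
    \<comment> \<open>\<open>order_refl\<close> instantiates both \<open>x\<close> and
      \<open>D\<close> with 1, as summability involves neither.\<close>
    show "summable (\<lambda>n. f (Suc n) / (of_nat (Suc n) * of_nat (Suc n + 1)))"
      using E(2)[THEN spec, THEN spec, THEN spec, THEN spec, THEN mp, OF conjI[OF A conjI[OF f conjI[OF order_refl order_refl]]]] ..
    fix x :: real assume "max x0 (exp (exp 1)) \<le> x"
    then have x: "x0 \<le> x" "exp (exp 1) \<le> x" by simp_all
    have x1: "x \<ge> 1" using x(2) one_le_exp_iff[of "exp 1 :: real"] exp_gt_zero[of "1::real"] by linarith
    have "ln x \<ge> exp 1" using x(2) x1 by (simp add: ln_ge_iff)
    then have L1: "ln x \<ge> 1" using one_le_exp_iff[of "1 :: real"] by linarith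
    obtain D where D: "D \<ge> 1" "(\<Sum>n | n \<ge> 1 \<and> real n \<le> x / real (D + 1). real (tau (Suc j) (nat \<lfloor>x / real n\<rfloor>)))
             + real D * (1 + ln (real D)) ^ j + E * x * (1 + ln (real D)) ^ j / real D
           \<le> K * (sqrt x * ln x powr delta k)" using K(2)[OF x(1)] by blast
    have "norm ((\<Sum>n = 1..nat \<lfloor>x\<rfloor>. f (nat \<lfloor>x / real n\<rfloor>))
             - of_real x * (\<Sum>n. f (Suc n) / (of_nat (Suc n) * of_nat (Suc n + 1))))
         \<le> A * ((\<Sum>n | n \<ge> 1 \<and> real n \<le> x / real (D + 1). real (tau (Suc j) (nat \<lfloor>x / real n\<rfloor>)))
             + real D * (1 + ln (real D)) ^ j + E * x * (1 + ln (real D)) ^ j / real D)"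
      using E(2)[THEN spec, THEN spec, THEN spec, THEN spec, THEN mp, OF conjI[OF A conjI[OF f conjI[OF x1 D(1)]]]] ..
    also have "\<dots> \<le> A * (K * (sqrt x * ln x powr delta k))"
      using A D(2) by (intro mult_left_mono) auto
    \<comment> \<open>Since \<open>ln x \<ge> 1\<close>, a non-negative addition to the exponent
      only weakens the bound.\<close>
    also have "\<dots> \<le> A * (K * (sqrt x * ln x powr (delta k + eps (k + 1) x / 2)))"
      using A K(1) x1 L1 eps_nonneg[OF _ x(2), of "k + 1"] by (intro mult_left_mono powr_mono) auto
    also have "\<dots> = K * (A * x powr (1/2) * ln x powr (delta k + eps (k + 1) x / 2))"
      using x1 by (simp add: powr_half_sqrt)
    finally show "norm ((\<Sum>n = 1..nat \<lfloor>x\<rfloor>. f (nat \<lfloor>x / real n\<rfloor>))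
             - of_real x * (\<Sum>n. f (Suc n) / (of_nat (Suc n) * of_nat (Suc n + 1))))
         \<le> K * (A * x powr (1/2) * ln x powr (delta k + eps (k + 1) x / 2))" .
  qed
qed

end
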